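(* Consider the plant $\dot x_p=Ax_p+B_1w+B_2u$, $z=C_1x_p+D_{11}w+D_{12}u$, $y=C_2x_p+D_{21}w$, $x_p\in\mathbb{R}^n$, with disturbance satisfying $w(t)^Tw(t)\le w_{max}^2$ and actuator limit $u_{lim}$ ($w_{max},u_{lim}>0$). Suppose there exist $n\times n$ matrices $R,V$, a symmetric $n\times n$ matrix $Y$, symmetric matrices $$M_1=\left(\begin{array}{cc} M_{11} & M_{12} \\ M_{12}^T & M_{13} \end{array}\right),\qquad M_2=\left(\begin{array}{cc} M_{21} & M_{22} \\ M_{22}^T & M_{23} \end{array}\right)$$ with $n\times n$ blocks, general matrices $L,E,F$, a constant $\alpha_{new}>0$, small positive scalars $\epsilon_i<1$ ($i=1,2,3$) and a scalar $\gamma_{new}$ such that the following three matrix inequalities hold: $$\left(\begin{array}{cccccc} M_{11}+\mathbf{He}(\Pi) & M_{12}+\Omega & B_1 & R^TC_1^T+F^TD_{12}^T & \Delta_1 & \Gamma_1\\ \star & M_{13}+\mathbf{He}(\Lambda) & Y^TB_1+ED_{21} & C_1^T & \Upsilon_1 & \Sigma_1\\ \star&\star&-\gamma_{new}I&D_{11}^T&0&0\\ \star&\star&\star&-\gamma_{new}I&-2\epsilon_1(C_1R+D_{12}F)&-2\epsilon_1C_1\\ \star&\star&\star&\star&-2\epsilon_1\mathbf{He}(R)&-2\epsilon_1(I+V)\\ \star&\star&\star&\star&\star&-2\epsilon_1\mathbf{He}(Y)\end{array}\right)<0,$$ $$\left(\begin{array}{ccccc} M_{21}+\mathbf{He}(\frac{\alpha_{new}}{2}R+\Pi)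 & M_{22}+\frac{\alpha_{new}}{2}(I+V)+\Omega & B_1 & \Delta_2-2\epsilon_2(\frac{\alpha_{new}}{2}R) & \Gamma_2-2\epsilon_2(\frac{\alpha_{new}}{2}I)\\ \star & M_{23}+\mathbf{He}(\frac{\alpha_{new}}{2}Y+\Lambda) & Y^TB_1+ED_{21} & \Upsilon_2-2\epsilon_2(\frac{\alpha_{new}}{2}V^T) & \Sigma_2-2\epsilon_2(\frac{\alpha_{new}}{2}Y^T)\\ \star&\star&-\alpha_{new}I&0&0\\ \star&\star&\star&\mathbf{He}(-2\epsilon_2R)&-2\epsilon_2(I+V)\\ \star&\star&\star&\star&\mathbf{He}(-2\epsilon_2Y)\end{array}\right)<0,$$ $$\left(\begin{array}{ccccc} M_{21}-\mathbf{He}(R) & M_{22}-I-V & -F^T & -M_{21}+R^T+2\epsilon_3R & -M_{22}+V+2\epsilon_3I\\ \star & M_{23}-\mathbf{He}(Y) & 0 & -M_{22}^T+I+2\epsilon_3V^T & -M_{23}+Y+2\epsilon_3Y^T\\ \star&\star&-\frac{u_{lim}^2}{w_{max}^2}I&2\epsilon_3F&0\\ \star&\star&\star&\mathbf{He}(-2\epsilon_3R)&-2\epsilon_3(I+V)\\ \star&\star&\star&\star&\mathbf{He}(-2\epsilon_3Y)\end{array}\right)<0,$$ where $\Pi,\Lambda,\Omega,\Delta_i,\Sigma_i,\Gamma_i,\Upsilon_i$ are the expressions given in the context. Then there is a full-order output feedback compensator $\dot x_c=A_cx_c+B_cy$, $u=C_cx_c$ ($x_c\in\mathbb{R}^n$)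 for which the closed-loop system is internally stable, never saturates and has disturbance attenuation level $\gamma_{new}$. Moreover (after, if necessary, a small perturbation of the variables preserving the strict inequalities so that $V-R^TY$ is nonsingular), for any invertible $n\times n$ matrices $G_{21},H_{21}$ with $G_{21}^TH_{21}=V-R^TY$, such a compensator is given by $$C_c=FG_{21}^{-1},\qquad B_c=H_{21}^{-T}E,\qquad A_c=H_{21}^{-T}\left(L-Y^TAR-EC_2R-Y^TB_2F\right)G_{21}^{-1}.$$
   Context: $\mathbf{He}(A)=A+A^T$; $\star$ denotes entries determined by symmetry; for symmetric matrices $M<0$ means negative definite. The following abbreviations are used, for $i=1,2$: $$\Pi=AR+B_2F-\tfrac12R,\qquad \Lambda=YA+EC_2-\tfrac12Y^T,\qquad \Omega=-\tfrac12(I+V)+A+L^T,$$ $$\Delta_i=-M_{i1}+R^T-2\epsilon_i\Pi,\qquad \Sigma_i=-M_{i3}+Y-2\epsilon_i\Lambda,$$ $$\Gamma_i=-M_{i2}+V-2\epsilon_i(A-\tfrac12I),\qquad \Upsilon_i=-M_{i2}^T+I-2\epsilon_i(L-\tfrac12V^T).$$ $L$ is $n\times n$, $E$ is $n\times\dim y$, $F$ is $\dim u\times n$. With closed-loop state $x=[x_p^T\ x_c^T]^T$, the closed loop is $\dot x=A_{cl}x+B_{cl}w$, $z=C_{cl}x+D_{cl}w$ with $$A_{cl}=\left(\begin{array}{cc} A & B_2C_c \\ B_cC_2 & A_c \end{array}\right),\quad B_{cl}=\left(\begin{array}{c} B_1 \\ B_cD_{21} \end{array}\right),\quad C_{cl}=[\,C_1\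 \ D_{12}C_c\,],\quad D_{cl}=D_{11}.$$ "Internally stable" means $A_{cl}$ is Hurwitz. "Never saturates" means $\|u(t)\|\le u_{lim}$ for all $t\ge0$ along trajectories starting from $x(0)=0$ under any disturbance with $w(t)^Tw(t)\le w_{max}^2$. "Disturbance attenuation level $\gamma_{new}$" means the $L_2$ gain from $w$ to $z$ (the $H_\infty$ norm of the closed-loop transfer function) is less than $\gamma_{new}$. *)

theory Defs
  imports "HOL-Analysis.Analysis"
begin

definition hcat :: "real^'a^'m \<Rightarrow> real^'b^'m \<Rightarrow> real^('a + 'b)^'m" (infixr "|||" 60) where
  "P ||| Q = (\<chi> i j. case j of Inl a \<Rightarrow> P $ i $ a | Inr b \<Rightarrow> Q $ i $ b)"

definition vcat :: "real^'m^'a \<Rightarrow> real^'m^'b \<Rightarrow> real^'m^('a + 'b)" where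
  "vcat P Q = (\<chi> i. case i of Inl a \<Rightarrow> P $ a | Inr b \<Rightarrow> Q $ b)"

text \<open>The matrix with upper block row \<open>P, Q\<close> and lower block row \<open>Q\<^sup>T, S\<close>. Nesting it in the
  last argument writes a larger block matrix by its upper triangle, row by row.\<close>
definition symblk ::
  "real^'a^'a \<Rightarrow> real^'b^'a \<Rightarrow> real^'b^'b \<Rightarrow> real^('a + 'b)^('a + 'b)" where
  "symblk P Q S = vcat (P ||| Q) (transpose Q ||| S)"

definition symmetric_matrix :: "real^'n^'n \<Rightarrow> bool" where
  "symmetric_matrix M \<longleftrightarrow> transpose M = M"

definition neg_definite :: "real^'n^'n \<Rightarrow> bool" where
  "neg_definite M \<longleftrightarrow> symmetric_matrix M \<and> (\<forall>x. x \<noteq> 0 \<longrightarrow> x \<bullet> (M *v x) < 0)"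

definition He :: "real^'n^'n \<Rightarrow> real^'n^'n" where
  "He M = M + transpose M"



definition cmat :: "real^'n^'m \<Rightarrow> complex^'n^'m" where
  "cmat M = (\<chi> i j. complex_of_real (M $ i $ j))"

definition hurwitz :: "real^'n^'n \<Rightarrow> bool" where
  "hurwitz A \<longleftrightarrow> (\<forall>l v. v \<noteq> 0 \<and> cmat A *v v = l *s v \<longrightarrow> Re l < 0)"

definition transfer_function ::
  "real^'n^'n \<Rightarrow> real^'w^'n \<Rightarrow> real^'n^'z \<Rightarrow> real^'w^'z \<Rightarrow> complex \<Rightarrow> complex^'w^'z" where
  "transfer_function A B C D s = cmat D + cmat C ** matrix_inv (mat s - cmat A) ** cmat B"

text \<open>The operator norm with respect to the Euclidean norms is the largest singular value. This is
  the \<open>H\<^sub>\<infinity>\<close> norm when \<open>A\<close> is Hurwitz.\<close>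
definition hinf_norm ::
  "real^'n^'n \<Rightarrow> real^'w^'n \<Rightarrow> real^'n^'z \<Rightarrow> real^'w^'z \<Rightarrow> ereal" where
  "hinf_norm A B C D =
    (SUP \<omega>::real. ereal (onorm (\<lambda>v. transfer_function A B C D (\<i> * complex_of_real \<omega>) *v v)))"

text \<open>\<open>x' = A x + B w\<close> on \<open>[0, \<infinity>)\<close> with \<open>x(0) = 0\<close>, in integrated form, since the
  disturbance is only assumed to be measurable.\<close>
definition zero_state_trajectory ::
  "real^'n^'n \<Rightarrow> real^'w^'n \<Rightarrow> (real \<Rightarrow> real^'w) \<Rightarrow> (real \<Rightarrow> real^'n) \<Rightarrow> bool" where
  "zero_state_trajectory A B w x \<longleftrightarrow>
    x 0 = 0 \<and> (\<forall>t\<ge>0. ((\<lambda>s. A *v x s + B *v w s) has_integral x t) {0..t})"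

definition energy :: "(real \<Rightarrow> real^'n) \<Rightarrow> ennreal" where
  "energy f = (\<integral>\<^sup>+t. ennreal ((norm (f t))\<^sup>2) \<partial>lebesgue_on {0..})"

text \<open>The least \<open>g \<ge> 0\<close> with \<open>\<parallel>z\<parallel> \<le> g \<parallel>w\<parallel>\<close> in \<open>L\<^sub>2\<close> norms, and infinity if there is none.\<close>
definition l2_gain ::
  "real^'n^'n \<Rightarrow> real^'w^'n \<Rightarrow> real^'n^'z \<Rightarrow> real^'w^'z \<Rightarrow> ereal" where
  "l2_gain A B C D = Inf {ereal g | g. 0 \<le> g \<and>
    (\<forall>w x. w \<in> borel_measurable (lebesgue_on {0..}) \<and> energy w < \<infinity> \<and>
       zero_state_trajectory A B w x \<longrightarrow>
       energy (\<lambda>t. C *v x t + D *v w t) \<le> ennreal (g\<^sup>2) * energy w)}"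

text \<open>For Hurwitz \<open>A\<close> the two quantities coincide; the level is stated for both.\<close>
definition attenuation_level ::
  "real^'n^'n \<Rightarrow> real^'w^'n \<Rightarrow> real^'n^'z \<Rightarrow> real^'w^'z \<Rightarrow> real \<Rightarrow> bool" where
  "attenuation_level A B C D \<gamma> \<longleftrightarrow>
    l2_gain A B C D < ereal \<gamma> \<and> hinf_norm A B C D < ereal \<gamma>"



definition A_cl ::
  "real^'n^'n \<Rightarrow> real^'u^'n \<Rightarrow> real^'n^'y \<Rightarrow> real^'n^'n \<Rightarrow> real^'y^'n \<Rightarrow> real^'n^'u
    \<Rightarrow> real^('n + 'n)^('n + 'n)" where
  "A_cl A B2 C2 Ac Bc Cc = vcat (A ||| B2 ** Cc) (Bc ** C2 ||| Ac)"

definition B_cl ::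
  "real^'w^'n \<Rightarrow> real^'w^'y \<Rightarrow> real^'y^'n \<Rightarrow> real^'w^('n + 'n)" where
  "B_cl B1 D21 Bc = vcat B1 (Bc ** D21)"

definition C_cl ::
  "real^'n^'z \<Rightarrow> real^'u^'z \<Rightarrow> real^'n^'u \<Rightarrow> real^('n + 'n)^'z" where
  "C_cl C1 D12 Cc = (C1 ||| D12 ** Cc)"

definition compensator_state :: "real^('n + 'n) \<Rightarrow> real^'n" where
  "compensator_state x = (\<chi> i. x $ Inr i)"

definition never_saturates ::
  "real^'n^'n \<Rightarrow> real^'w^'n \<Rightarrow> real^'u^'n \<Rightarrow> real^'n^'y \<Rightarrow> real^'w^'y \<Rightarrow> real \<Rightarrow> real
    \<Rightarrow> real^'n^'n \<Rightarrow> real^'y^'n \<Rightarrow> real^'n^'u \<Rightarrow> bool" where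
  "never_saturates A B1 B2 C2 D21 wmax ulim Ac Bc Cc \<longleftrightarrow>
    (\<forall>w x. w \<in> borel_measurable (lebesgue_on {0..}) \<and> (\<forall>t\<ge>0. w t \<bullet> w t \<le> wmax\<^sup>2) \<and>
       zero_state_trajectory (A_cl A B2 C2 Ac Bc Cc) (B_cl B1 D21 Bc) w x \<longrightarrow>
       (\<forall>t\<ge>0. norm (Cc *v compensator_state (x t)) \<le> ulim))"

definition good_compensator ::
  "real^'n^'n \<Rightarrow> real^'w^'n \<Rightarrow> real^'u^'n \<Rightarrow> real^'n^'z \<Rightarrow> real^'n^'y
    \<Rightarrow> real^'w^'z \<Rightarrow> real^'u^'z \<Rightarrow> real^'w^'y \<Rightarrow> real \<Rightarrow> real \<Rightarrow> real
    \<Rightarrow> real^'n^'n \<Rightarrow> real^'y^'n \<Rightarrow> real^'n^'u \<Rightarrow> bool" where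
  "good_compensator A B1 B2 C1 C2 D11 D12 D21 wmax ulim \<gamma> Ac Bc Cc \<longleftrightarrow>
    hurwitz (A_cl A B2 C2 Ac Bc Cc) \<and>
    never_saturates A B1 B2 C2 D21 wmax ulim Ac Bc Cc \<and>
    attenuation_level (A_cl A B2 C2 Ac Bc Cc) (B_cl B1 D21 Bc) (C_cl C1 D12 Cc) D11 \<gamma>"



definition Pi_blk :: "real^'n^'n \<Rightarrow> real^'u^'n \<Rightarrow> real^'n^'n \<Rightarrow> real^'n^'u \<Rightarrow> real^'n^'n" where
  "Pi_blk A B2 R F = A ** R + B2 ** F - (1/2) *\<^sub>R R"

definition Lambda_blk ::
  "real^'n^'n \<Rightarrow> real^'n^'y \<Rightarrow> real^'n^'n \<Rightarrow> real^'y^'n \<Rightarrow> real^'n^'n" where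
  "Lambda_blk A C2 Y E = Y ** A + E ** C2 - (1/2) *\<^sub>R transpose Y"

definition Omega_blk :: "real^'n^'n \<Rightarrow> real^'n^'n \<Rightarrow> real^'n^'n \<Rightarrow> real^'n^'n" where
  "Omega_blk A V L = - ((1/2) *\<^sub>R (mat 1 + V)) + A + transpose L"

text \<open>In the next four definitions \<open>Ma\<close>, \<open>Mb\<close>, \<open>Mc\<close> are the blocks \<open>M\<^sub>i\<^sub>1\<close>, \<open>M\<^sub>i\<^sub>2\<close>, \<open>M\<^sub>i\<^sub>3\<close>, and
  \<open>P\<close>, \<open>Q\<close> are \<open>\<Pi>\<close>, \<open>\<Lambda>\<close>.\<close>
definition Delta_blk :: "real^'n^'n \<Rightarrow> real^'n^'n \<Rightarrow> real \<Rightarrow> real^'n^'n \<Rightarrow> real^'n^'n" where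
  "Delta_blk Ma R \<epsilon> P = - Ma + transpose R - (2 * \<epsilon>) *\<^sub>R P"

definition Sigma_blk :: "real^'n^'n \<Rightarrow> real^'n^'n \<Rightarrow> real \<Rightarrow> real^'n^'n \<Rightarrow> real^'n^'n" where
  "Sigma_blk Mc Y \<epsilon> Q = - Mc + Y - (2 * \<epsilon>) *\<^sub>R Q"

definition Gamma_blk :: "real^'n^'n \<Rightarrow> real^'n^'n \<Rightarrow> real \<Rightarrow> real^'n^'n \<Rightarrow> real^'n^'n" where
  "Gamma_blk Mb V \<epsilon> A = - Mb + V - (2 * \<epsilon>) *\<^sub>R (A - (1/2) *\<^sub>R mat 1)"

definition Upsilon_blk ::
  "real^'n^'n \<Rightarrow> real^'n^'n \<Rightarrow> real \<Rightarrow> real^'n^'n \<Rightarrow> real^'n^'n" where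
  "Upsilon_blk Mb V \<epsilon> L =
    - transpose Mb + mat 1 - (2 * \<epsilon>) *\<^sub>R (L - (1/2) *\<^sub>R transpose V)"

definition performance_matrix ::
  "real^'n^'n \<Rightarrow> real^'w^'n \<Rightarrow> real^'u^'n \<Rightarrow> real^'n^'z \<Rightarrow> real^'n^'y
    \<Rightarrow> real^'w^'z \<Rightarrow> real^'u^'z \<Rightarrow> real^'w^'y
    \<Rightarrow> real^'n^'n \<Rightarrow> real^'n^'n \<Rightarrow> real^'n^'n \<Rightarrow> real^'n^'n \<Rightarrow> real^'n^'n \<Rightarrow> real^'n^'n
    \<Rightarrow> real^'n^'n \<Rightarrow> real^'y^'n \<Rightarrow> real^'n^'u \<Rightarrow> real \<Rightarrow> real
    \<Rightarrow> real^('n + 'n + 'w + 'z + 'n + 'n)^('n + 'n + 'w + 'z + 'n + 'n)" where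
  "performance_matrix A B1 B2 C1 C2 D11 D12 D21 R V Y Ma Mb Mc L E F \<epsilon> \<gamma> =
    (let P = Pi_blk A B2 R F; Q = Lambda_blk A C2 Y E; O' = Omega_blk A V L;
         De = Delta_blk Ma R \<epsilon> P; Si = Sigma_blk Mc Y \<epsilon> Q;
         Ga = Gamma_blk Mb V \<epsilon> A; Up = Upsilon_blk Mb V \<epsilon> L
     in
       symblk (Ma + He P)
         (Mb + O' ||| B1 ||| transpose R ** transpose C1 + transpose F ** transpose D12 ||| De ||| Ga)
      (symblk (Mc + He Q)
         (transpose Y ** B1 + E ** D21 ||| transpose C1 ||| Up ||| Si)
      (symblk (- \<gamma> *\<^sub>R mat 1)
         (transpose D11 ||| 0 ||| 0)
      (symblk (- \<gamma> *\<^sub>R mat 1)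
         ((- 2 * \<epsilon>) *\<^sub>R (C1 ** R + D12 ** F) ||| (- 2 * \<epsilon>) *\<^sub>R C1)
      (symblk ((- 2 * \<epsilon>) *\<^sub>R He R)
         ((- 2 * \<epsilon>) *\<^sub>R (mat 1 + V))
      ((- 2 * \<epsilon>) *\<^sub>R He Y))))))"

definition reachability_matrix ::
  "real^'n^'n \<Rightarrow> real^'w^'n \<Rightarrow> real^'u^'n \<Rightarrow> real^'n^'y \<Rightarrow> real^'w^'y
    \<Rightarrow> real^'n^'n \<Rightarrow> real^'n^'n \<Rightarrow> real^'n^'n \<Rightarrow> real^'n^'n \<Rightarrow> real^'n^'n \<Rightarrow> real^'n^'n
    \<Rightarrow> real^'n^'n \<Rightarrow> real^'y^'n \<Rightarrow> real^'n^'u \<Rightarrow> real \<Rightarrow> real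
    \<Rightarrow> real^('n + 'n + 'w + 'n + 'n)^('n + 'n + 'w + 'n + 'n)" where
  "reachability_matrix A B1 B2 C2 D21 R V Y Ma Mb Mc L E F \<epsilon> \<alpha> =
    (let P = Pi_blk A B2 R F; Q = Lambda_blk A C2 Y E; O' = Omega_blk A V L;
         De = Delta_blk Ma R \<epsilon> P; Si = Sigma_blk Mc Y \<epsilon> Q;
         Ga = Gamma_blk Mb V \<epsilon> A; Up = Upsilon_blk Mb V \<epsilon> L
     in
       symblk (Ma + He ((\<alpha>/2) *\<^sub>R R + P))
         (Mb + (\<alpha>/2) *\<^sub>R (mat 1 + V) + O' ||| B1
           ||| De - (2 * \<epsilon>) *\<^sub>R ((\<alpha>/2) *\<^sub>R R) ||| Ga - (2 * \<epsilon>) *\<^sub>R ((\<alpha>/2) *\<^sub>R mat 1))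
      (symblk (Mc + He ((\<alpha>/2) *\<^sub>R Y + Q))
         (transpose Y ** B1 + E ** D21
           ||| Up - (2 * \<epsilon>) *\<^sub>R ((\<alpha>/2) *\<^sub>R transpose V)
           ||| Si - (2 * \<epsilon>) *\<^sub>R ((\<alpha>/2) *\<^sub>R transpose Y))
      (symblk (- \<alpha> *\<^sub>R mat 1)
         (0 ||| 0)
      (symblk (He ((- 2 * \<epsilon>) *\<^sub>R R))
         ((- 2 * \<epsilon>) *\<^sub>R (mat 1 + V))
      (He ((- 2 * \<epsilon>) *\<^sub>R Y))))))"

text \<open>\<open>\<rho>\<close> stands for \<open>u\<^sub>l\<^sub>i\<^sub>m\<^sup>2 / w\<^sub>m\<^sub>a\<^sub>x\<^sup>2\<close>.\<close>
definition saturation_matrix ::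
  "real^'n^'n \<Rightarrow> real^'n^'n \<Rightarrow> real^'n^'n \<Rightarrow> real^'n^'n \<Rightarrow> real^'n^'n \<Rightarrow> real^'n^'n
    \<Rightarrow> real^'n^'u \<Rightarrow> real \<Rightarrow> real
    \<Rightarrow> real^('n + 'n + 'u + 'n + 'n)^('n + 'n + 'u + 'n + 'n)" where
  "saturation_matrix R V Y Ma Mb Mc F \<epsilon> \<rho> =
       symblk (Ma - He R)
         (Mb - mat 1 - V ||| - transpose F ||| - Ma + transpose R + (2 * \<epsilon>) *\<^sub>R R
           ||| - Mb + V + (2 * \<epsilon>) *\<^sub>R mat 1)
      (symblk (Mc - He Y)
         (0 ||| - transpose Mb + mat 1 + (2 * \<epsilon>) *\<^sub>R transpose V
           ||| - Mc + Y + (2 * \<epsilon>) *\<^sub>R transpose Y)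
      (symblk (- \<rho> *\<^sub>R mat 1)
         ((2 * \<epsilon>) *\<^sub>R F ||| 0)
      (symblk (He ((- 2 * \<epsilon>) *\<^sub>R R))
         ((- 2 * \<epsilon>) *\<^sub>R (mat 1 + V))
      (He ((- 2 * \<epsilon>) *\<^sub>R Y)))))"

definition lmi_feasible ::
  "real^'n^'n \<Rightarrow> real^'w^'n \<Rightarrow> real^'u^'n \<Rightarrow> real^'n^'z \<Rightarrow> real^'n^'y
    \<Rightarrow> real^'w^'z \<Rightarrow> real^'u^'z \<Rightarrow> real^'w^'y \<Rightarrow> real \<Rightarrow> real
    \<Rightarrow> real \<Rightarrow> real \<Rightarrow> real \<Rightarrow> real \<Rightarrow> real
    \<Rightarrow> real^'n^'n \<Rightarrow> real^'n^'n \<Rightarrow> real^'n^'n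
    \<Rightarrow> real^'n^'n \<Rightarrow> real^'n^'n \<Rightarrow> real^'n^'n \<Rightarrow> real^'n^'n \<Rightarrow> real^'n^'n \<Rightarrow> real^'n^'n
    \<Rightarrow> real^'n^'n \<Rightarrow> real^'y^'n \<Rightarrow> real^'n^'u \<Rightarrow> bool" where
  "lmi_feasible A B1 B2 C1 C2 D11 D12 D21 wmax ulim \<alpha> \<gamma> \<epsilon>1 \<epsilon>2 \<epsilon>3
      R V Y M11 M12 M13 M21 M22 M23 L E F \<longleftrightarrow>
    symmetric_matrix Y \<and>
    symmetric_matrix (symblk M11 M12 M13) \<and>
    symmetric_matrix (symblk M21 M22 M23) \<and>
    neg_definite
      (performance_matrix A B1 B2 C1 C2 D11 D12 D21 R V Y M11 M12 M13 L E F \<epsilon>1 \<gamma>) \<and>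
    neg_definite (reachability_matrix A B1 B2 C2 D21 R V Y M21 M22 M23 L E F \<epsilon>2 \<alpha>) \<and>
    neg_definite (saturation_matrix R V Y M21 M22 M23 F \<epsilon>3 (ulim\<^sup>2 / wmax\<^sup>2))"

end

theory Submission
  imports Defs
begin

text \<open>
  Each of the three inequalities is a dilated version of a Lyapunov-type inequality for the closed
  loop. Put \<open>G = (R, I; V\<^sup>T, Y\<^sup>T)\<close> and \<open>N = (AR + B\<^sub>2F, A; L, YA + EC\<^sub>2) + \<kappa> G\<close>, with
  \<open>\<kappa> = -1/2\<close>, \<open>(\<alpha> - 1)/2\<close> for the first two inequalities; in the third one \<open>N = -G\<close>. On vectors
  \<open>(p, w, z, q)\<close> with \<open>p, q\<close> of the size of the closed-loop state, the quadratic form of the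
  big matrix is
  \<open>p\<cdot>Mp - 2 p\<cdot>Mq + 2 (N\<^sup>Tp + C\<^sup>Tz + G\<^sup>Tq)\<cdot>(p - 2\<epsilon>q)\<close> plus terms in \<open>w\<close>, \<open>z\<close> and \<open>p\<cdot>Bw\<close>.
  The change of variables is made so that \<open>N\<close>, \<open>G\<close>, \<open>B\<close>, \<open>C\<close> factor through the closed loop:
  \<open>G = WU\<close>, \<open>N = W(A\<^sub>c\<^sub>l + \<kappa> I)U\<close>, \<open>C = C\<^sub>c\<^sub>lU\<close>, \<open>B = WB\<^sub>c\<^sub>l\<close> with
  \<open>U = (R, I; G\<^sub>2\<^sub>1, 0)\<close> and the invertible \<open>W = (I, 0; Y, H\<^sub>2\<^sub>1\<^sup>T)\<close>. Hence one can choose \<open>q\<close> so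
  that the middle term vanishes for every \<open>\<epsilon>\<close>. With \<open>s = W\<^sup>Tp\<close> and \<open>X = W\<^sup>-\<^sup>1MW\<^sup>-\<^sup>T\<close>
  what is left are the inequalities of \<open>closed_loop_inequalities\<close>: a bounded real
  inequality for \<open>X\<^sub>1\<close>, a reachability inequality for \<open>X\<^sub>2\<close>, and an output bound for \<open>X\<^sub>2\<close>.

  The output bound gives \<open>X\<^sub>2 > 0\<close>, so the reachability inequality makes \<open>A\<^sub>c\<^sub>l\<close> Hurwitz
  (\<open>lyapunov_hurwitz\<close>) and the ellipsoid \<open>x\<cdot>X\<^sub>2\<^sup>-\<^sup>1x \<le> w\<^sub>m\<^sub>a\<^sub>x\<^sup>2\<close> invariant
  (\<open>reachable_ellipsoid\<close>); on this ellipsoid the output bound reads \<open>\<parallel>u\<parallel> \<le> u\<^sub>l\<^sub>i\<^sub>m\<close>.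
  Positivity of \<open>X\<^sub>1\<close> is not among the hypotheses: it follows by comparing \<open>X\<^sub>1\<close> with \<open>X\<^sub>2\<close>
  (\<open>lyapunov_solution_pos_definite\<close>). The bounded real inequality then gives the attenuation
  level, in the time domain by integrating \<open>d/dt (x\<cdot>X\<^sub>1\<^sup>-\<^sup>1x)\<close> and in the frequency domain by
  evaluating it at the response to a sinusoid (\<open>bounded_real_attenuation\<close>). Since disturbances are
  only measurable, trajectories are only absolutely continuous, and the integration is done
  in \<open>quadratic_form_increment\<close> without a derivative.

  For the perturbation it suffices to replace \<open>V\<close> by \<open>V + tI\<close>, because \<open>det (V - R\<^sup>TY + tI)\<close> is a
  nonzero polynomial in \<open>t\<close>. Existence of a compensator follows from the formulas, applied to the
  perturbed variables with \<open>G\<^sub>2\<^sub>1 = I\<close>.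
\<close>

section \<open>The matrix inequalities as quadratic forms\<close>

definition vjoin :: "real^'a \<Rightarrow> real^'b \<Rightarrow> real^('a + 'b)" where
  "vjoin p r = (\<chi> i. case i of Inl a \<Rightarrow> p $ a | Inr b \<Rightarrow> r $ b)"

lemma sum_over_sum_type:
  fixes f :: "'a::finite + 'b::finite \<Rightarrow> 'c::comm_monoid_add"
  shows "(\<Sum>i\<in>UNIV. f i) = (\<Sum>a\<in>UNIV. f (Inl a)) + (\<Sum>b\<in>UNIV. f (Inr b))"
  using sum.Plus[of "UNIV::'a set" "UNIV::'b set" f] by (simp add: UNIV_Plus_UNIV)

lemma vjoin_inner [simp]: "vjoin p r \<bullet> vjoin p' r' = p \<bullet> p' + r \<bullet> r'"
  by (simp add: inner_vec_def vjoin_def sum_over_sum_type)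

lemma vjoin_eq_iff [simp]: "vjoin p r = vjoin p' r' \<longleftrightarrow> p = p' \<and> r = r'"
  by (auto simp: vjoin_def vec_eq_iff split: sum.splits)

lemma vjoin_eq_0_iff [simp]: "vjoin p r = 0 \<longleftrightarrow> p = 0 \<and> r = 0"
  by (auto simp: vjoin_def vec_eq_iff split: sum.splits)

lemma vjoin_arith:
  "vjoin p r + vjoin p' r' = vjoin (p + p') (r + r')"
  "vjoin p r - vjoin p' r' = vjoin (p - p') (r - r')"
  "c *\<^sub>R vjoin p r = vjoin (c *\<^sub>R p) (c *\<^sub>R r)"
  by (auto simp: vjoin_def vec_eq_iff split: sum.splits)

lemma vjoin_exhaust:
  obtains p r where "x = vjoin p r"
proof
  show "x = vjoin (\<chi> i. x $ Inl i) (\<chi> i. x $ Inr i)"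
    by (auto simp: vjoin_def vec_eq_iff split: sum.splits)
qed

lemma hcat_mult [simp]: "(P ||| Q) *v vjoin p r = P *v p + Q *v r"
  by (simp add: matrix_vector_mult_def hcat_def vjoin_def vec_eq_iff sum_over_sum_type)

lemma vcat_mult [simp]: "vcat P Q *v x = vjoin (P *v x) (Q *v x)"
  by (simp add: matrix_vector_mult_def vcat_def vjoin_def vec_eq_iff split: sum.splits)

lemma inner_vector_matrix_mult:
  "(y::real^'n) \<bullet> (x v* A) = x \<bullet> (A *v y)"
  by (metis dot_lmul_matrix inner_commute)

lemma symblk_mult [simp]:
  "symblk P Q S *v vjoin p r = vjoin (P *v p + Q *v r) (p v* Q + S *v r)"
  by (simp add: symblk_def)

text \<open>Applied repeatedly, this expands a nested block matrix from its upper triangle alone.\<close>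
lemma symblk_form:
  "vjoin p r \<bullet> (symblk P Q S *v vjoin p r) =
     p \<bullet> (P *v p) + 2 * (p \<bullet> (Q *v r)) + r \<bullet> (S *v r)"
  by (simp add: inner_add_right inner_vector_matrix_mult)

lemma scaleR_matrix_vector_mult: "(c *\<^sub>R (A::real^'n^'m)) *v x = c *\<^sub>R (A *v x)"
  by (simp add: scaleR_matrix_vector_assoc)

lemma uminus_matrix_vector_mult: "(- (A::real^'n^'m)) *v x = - (A *v x)"
  by (simp add: matrix_vector_mult_def vec_eq_iff sum_negf)

text \<open>The next two matrices are what the products \<open>WU\<close> and \<open>WA\<^sub>c\<^sub>lU\<close> become in terms of the
  variables of the matrix inequalities; see \<open>closed_loop_factorization\<close>.\<close>
definition slack_blk :: "real^'n^'n \<Rightarrow> real^'n^'n \<Rightarrow> real^'n^'n \<Rightarrow> real^('n + 'n)^('n + 'n)" where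
  "slack_blk R V Y = vcat (R ||| mat 1) (transpose V ||| transpose Y)"

definition state_blk ::
  "real^'n^'n \<Rightarrow> real^'u^'n \<Rightarrow> real^'n^'y \<Rightarrow> real^'n^'n \<Rightarrow> real^'n^'n
    \<Rightarrow> real^'n^'n \<Rightarrow> real^'y^'n \<Rightarrow> real^'n^'u \<Rightarrow> real^('n + 'n)^('n + 'n)" where
  "state_blk A B2 C2 R Y L E F =
     vcat (A ** R + B2 ** F ||| A) (L ||| Y ** A + E ** C2)"

text \<open>The part of the quadratic forms that the three inequalities share. It is written so that the
  vector \<open>p - 2\<epsilon>q\<close>, the only place where \<open>\<epsilon>\<close> occurs, multiplies one linear expression in
  \<open>p, z, q\<close>; annihilating that expression removes \<open>\<epsilon>\<close>.\<close>
definition dilated_form ::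
  "real^'m^'m \<Rightarrow> real^'m^'m \<Rightarrow> real^'m^'m \<Rightarrow> real^'m^'z
    \<Rightarrow> real \<Rightarrow> real^'m \<Rightarrow> real^'z \<Rightarrow> real^'m \<Rightarrow> real"
  where
  "dilated_form M N G C \<epsilon> p z q =
     p \<bullet> (M *v p) - 2 * (p \<bullet> (M *v q)) +
     2 * (p \<bullet> (N *v (p - (2 * \<epsilon>) *\<^sub>R q)) + z \<bullet> (C *v (p - (2 * \<epsilon>) *\<^sub>R q))
          + q \<bullet> (G *v (p - (2 * \<epsilon>) *\<^sub>R q)))"

text \<open>The last two rules move a transposed matrix to the other side of the inner product, so that
  every term of a quadratic form becomes \<open>x\<cdot>(P\<^sub>1 \<dots> P\<^sub>ky)\<close>.\<close>
lemmas form_simps =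
  inner_add_right inner_add_left inner_diff_right inner_diff_left
  inner_minus_left inner_minus_right inner_scaleR_left inner_scaleR_right
  matrix_vector_mult_add_rdistrib matrix_vector_mult_diff_rdistrib
  matrix_vector_mult_scaleR scaleR_matrix_vector_mult uminus_matrix_vector_mult
  matrix_vector_mult_diff_distrib matrix_vector_right_distrib
  matrix_vector_mul_assoc[symmetric] dot_lmul_matrix inner_vector_matrix_mult

text \<open>Each inequality is reduced to the shared form by expanding both sides into terms \<open>x\<cdot>Py\<close>.\<close>
lemma performance_form:
  "vjoin p1 (vjoin p2 (vjoin w (vjoin z (vjoin q1 q2)))) \<bullet>
     (performance_matrix A B1 B2 C1 C2 D11 D12 D21 R V Y Ma Mb Mc L E F \<epsilon> \<gamma> *v
       vjoin p1 (vjoin p2 (vjoin w (vjoin z (vjoin q1 q2))))) =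
   dilated_form (symblk Ma Mb Mc)
     (state_blk A B2 C2 R Y L E F - (1/2) *\<^sub>R slack_blk R V Y) (slack_blk R V Y)
     (C1 ** R + D12 ** F ||| C1) \<epsilon> (vjoin p1 p2) z (vjoin q1 q2)
   + 2 * (vjoin p1 p2 \<bullet> (vcat B1 (transpose Y ** B1 + E ** D21) *v w))
   + 2 * (z \<bullet> (D11 *v w)) - \<gamma> * (w \<bullet> w) - \<gamma> * (z \<bullet> z)"
  unfolding performance_matrix_def Let_def symblk_form dilated_form_def slack_blk_def state_blk_def
    Pi_blk_def Lambda_blk_def Omega_blk_def Delta_blk_def Sigma_blk_def Gamma_blk_def
    Upsilon_blk_def He_def vjoin_arith vcat_mult hcat_mult symblk_mult
  by (simp add: vjoin_arith form_simps)
    (simp add: inner_commute inner_vector_matrix_mult dot_lmul_matrix, simp add: field_simps)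

lemma reachability_form:
  "vjoin p1 (vjoin p2 (vjoin w (vjoin q1 q2))) \<bullet>
     (reachability_matrix A B1 B2 C2 D21 R V Y Ma Mb Mc L E F \<epsilon> \<alpha> *v
       vjoin p1 (vjoin p2 (vjoin w (vjoin q1 q2)))) =
   dilated_form (symblk Ma Mb Mc)
     (state_blk A B2 C2 R Y L E F + (\<alpha>/2 - 1/2) *\<^sub>R slack_blk R V Y) (slack_blk R V Y)
     (0 :: real^('n+'n)^'n) \<epsilon> (vjoin p1 p2) 0 (vjoin q1 q2)
   + 2 * (vjoin p1 p2 \<bullet> (vcat B1 (transpose Y ** B1 + E ** D21) *v w)) - \<alpha> * (w \<bullet> w)"
  for A :: "real^'n^'n"
  unfolding reachability_matrix_def Let_def symblk_form dilated_form_def slack_blk_def state_blk_def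
    Pi_blk_def Lambda_blk_def Omega_blk_def Delta_blk_def Sigma_blk_def Gamma_blk_def
    Upsilon_blk_def He_def vjoin_arith vcat_mult hcat_mult symblk_mult
  by (simp add: vjoin_arith form_simps)
    (simp add: inner_commute inner_vector_matrix_mult dot_lmul_matrix, simp add: field_simps)

lemma saturation_form:
  "vjoin p1 (vjoin p2 (vjoin u (vjoin q1 q2))) \<bullet>
     (saturation_matrix R V Y Ma Mb Mc F \<epsilon> \<rho> *v
       vjoin p1 (vjoin p2 (vjoin u (vjoin q1 q2)))) =
   dilated_form (symblk Ma Mb Mc)
     (- slack_blk R V Y) (slack_blk R V Y)
     (- F ||| 0) \<epsilon> (vjoin p1 p2) u (vjoin q1 q2) - \<rho> * (u \<bullet> u)"
  unfolding saturation_matrix_def Let_def symblk_form dilated_form_def slack_blk_def state_blk_def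
    He_def vjoin_arith
    vcat_mult hcat_mult symblk_mult
  by (simp add: vjoin_arith form_simps)
    (simp add: inner_commute inner_vector_matrix_mult dot_lmul_matrix, simp add: field_simps)

text \<open>The choice of \<open>q\<close> is the solution of \<open>N\<^sup>Tp + C\<^sup>Tz + G\<^sup>Tq = 0\<close>: all three matrices have the
  right factor \<open>U\<close>, and after cancelling it the equation determines \<open>W\<^sup>Tq\<close>. The vector \<open>s\<close> is
  \<open>W\<^sup>Tp\<close>, and \<open>W'\<close> is the inverse of \<open>W\<close>.\<close>
lemma dilated_form_elimination:
  fixes A U W W' M :: "real^'m^'m" and C :: "real^'m^'z"
  assumes W: "W' ** W = mat 1"
    and N: "N = W ** A ** U + \<kappa> *\<^sub>R (W ** U)" and G: "G = W ** U" and C: "C = K ** U"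
    and X: "X = W' ** M ** transpose W'" and p: "p = s v* W'"
    and q: "q = (- (s v* A) - \<kappa> *\<^sub>R s - z v* K) v* W'"
    and M: "transpose M = M"
  shows "dilated_form M N G C \<epsilon> p z q = 
    (1 + 2 * \<kappa>) * (s \<bullet> (X *v s)) + 2 * ((s v* A) \<bullet> (X *v s)) + 2 * (z \<bullet> (K *v (X *v s)))"
proof -
  \<comment> \<open>\<open>r\<close> is \<open>W\<^sup>Tq\<close>.\<close>
  define r where "r = - (s v* A) - \<kappa> *\<^sub>R s - z v* K"
  have pW: "p \<bullet> (W *v y) = s \<bullet> y" for y
    using W by (simp add: p dot_lmul_matrix matrix_vector_mul_assoc)
  have qW: "q \<bullet> (W *v y) = r \<bullet> y" for y
    using W by (simp add: q r_def[symmetric] dot_lmul_matrix matrix_vector_mul_assoc)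
  have pq: "p \<bullet> (M *v q) = r \<bullet> (X *v s)"
  proof -
    have "p \<bullet> (M *v q) = q \<bullet> (M *v p)"
      using M by (metis dot_lmul_matrix inner_commute transpose_matrix_vector)
    then show ?thesis
      by (simp add: q r_def[symmetric] X p dot_lmul_matrix matrix_vector_mul_assoc[symmetric])
  qed
  have pp: "p \<bullet> (M *v p) = s \<bullet> (X *v s)"
    by (simp add: X p dot_lmul_matrix matrix_vector_mul_assoc[symmetric])
  have "p \<bullet> (N *v y) + z \<bullet> (C *v y) + q \<bullet> (G *v y) = 0" for y
    by (simp add: N G C matrix_vector_mul_assoc[symmetric] matrix_vector_mult_add_rdistrib
      scaleR_matrix_vector_mult inner_add_right pW qW r_def dot_lmul_matrix inner_diff_left)
  from this[of "p - (2 * \<epsilon>) *\<^sub>R q"] show ?thesis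
    unfolding dilated_form_def
    by (simp add: pq pp r_def inner_diff_left dot_lmul_matrix algebra_simps)
qed

section \<open>Definite matrices and Lyapunov inequalities\<close>

definition pos_definite :: "real^'n^'n \<Rightarrow> bool" where
  "pos_definite P \<longleftrightarrow> symmetric_matrix P \<and> (\<forall>x. x \<noteq> 0 \<longrightarrow> 0 < x \<bullet> (P *v x))"

lemma matrix_inv_mult:
  fixes A :: "'a::field^'n^'n"
  assumes "invertible A"
  shows "A ** matrix_inv A = mat 1" "matrix_inv A ** A = mat 1"
  using someI_ex[OF assms[unfolded invertible_def]] by (simp_all add: matrix_inv_def)

lemma symmetric_matrix_inner:
  assumes "symmetric_matrix P"
  shows "x \<bullet> (P *v y) = y \<bullet> (P *v x)"
  using assms unfolding symmetric_matrix_def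
  by (metis dot_lmul_matrix inner_commute transpose_matrix_vector)

lemma pos_definite_inverse:
  fixes X :: "real^'n^'n"
  assumes "pos_definite X"
  obtains P where "pos_definite P" "X ** P = mat 1"
proof -
  have "x = 0" if "X *v x = 0" for x
  proof (rule ccontr)
    assume "x \<noteq> 0"
    then have "0 < x \<bullet> (X *v x)" using assms by (simp add: pos_definite_def)
    then show False using that by simp
  qed
  then obtain P where PX: "P ** X = mat 1"
    using matrix_left_invertible_ker[of X] by auto
  then have XP: "X ** P = mat 1"
    by (simp add: matrix_left_right_inverse)
  have sX: "transpose X = X" using assms by (simp add: pos_definite_def symmetric_matrix_def)
  have "transpose P ** X = mat 1"
    using XP sX by (metis matrix_transpose_mul transpose_mat)
  then have "transpose P = P"
    by (metis XP matrix_mul_assoc matrix_mul_lid matrix_mul_rid)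
  moreover have "0 < x \<bullet> (P *v x)" if "x \<noteq> 0" for x
  proof -
    have x: "x = X *v (P *v x)" using XP by (simp add: matrix_vector_mul_assoc)
    then have "P *v x \<noteq> 0" using that by auto
    then have "0 < (P *v x) \<bullet> (X *v (P *v x))" using assms by (simp add: pos_definite_def)
    then show ?thesis using x by (simp add: inner_commute)
  qed
  ultimately show ?thesis
    using that XP by (auto simp: pos_definite_def symmetric_matrix_def)
qed

text \<open>If \<open>Dv \<noteq> 0\<close>, moving from \<open>v\<close> a little in the direction \<open>-Dv\<close> would make the form negative.\<close>
lemma psd_null_vector:
  fixes D :: "real^'n^'n"
  assumes "symmetric_matrix D" and psd: "\<And>u. 0 \<le> u \<bullet> (D *v u)" and v: "v \<bullet> (D *v v) = 0"
  shows "D *v v = 0"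
proof (rule ccontr)
  assume "D *v v \<noteq> 0"
  define u where "u = D *v v"
  define a where "a = u \<bullet> u"
  define c where "c = u \<bullet> (D *v u)"
  \<comment> \<open>Any \<open>t > 0\<close> with \<open>tc < 2a\<close> would do.\<close>
  define t where "t = a / (c + 1)"
  have a: "0 < a" using \<open>D *v v \<noteq> 0\<close> by (simp add: a_def u_def)
  have c: "0 \<le> c" using psd by (simp add: c_def)
  have t: "0 < t" using a c by (simp add: t_def)
  have "v \<bullet> (D *v u) = a"
    using symmetric_matrix_inner[OF assms(1), of v u] by (simp add: a_def u_def)
  then have "(v - t *\<^sub>R u) \<bullet> (D *v (v - t *\<^sub>R u)) = t * (t * c - 2 * a)"
    using v by (simp add: matrix_vector_mult_diff_distrib matrix_vector_mult_scaleR
        inner_diff_left inner_diff_right u_def[symmetric] a_def[symmetric] c_def[symmetric] algebra_simps)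
  moreover have "t * c \<le> a"
    using a c by (simp add: t_def field_simps)
  ultimately have "(v - t *\<^sub>R u) \<bullet> (D *v (v - t *\<^sub>R u)) < 0"
    using a t by (simp add: mult_pos_neg)
  then show False using psd by (metis not_less)
qed

text \<open>A minimizer \<open>v\<close> of the Rayleigh quotient \<open>l = (v\<cdot>Xv) / (v\<cdot>Zv)\<close> satisfies \<open>Xv = lZv\<close>. Then
  \<open>v\<cdot>AXv = l (v\<cdot>AZv)\<close>, and both values of the form are negative, so the minimum \<open>l\<close> is positive.\<close>
lemma lyapunov_solution_pos_definite:
  fixes A X Z :: "real^'n^'n"
  assumes Z: "pos_definite Z" and AZ: "\<And>s. s \<noteq> 0 \<Longrightarrow> s \<bullet> (A *v (Z *v s)) < 0"
    and X: "symmetric_matrix X" and AX: "\<And>s. s \<noteq> 0 \<Longrightarrow> s \<bullet> (A *v (X *v s)) < 0"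
  shows "pos_definite X"
proof -
  define f where "f = (\<lambda>v. (v \<bullet> (X *v v)) / (v \<bullet> (Z *v v)))"
  have Zpos: "0 < v \<bullet> (Z *v v)" if "v \<noteq> 0" for v
    using Z that by (simp add: pos_definite_def)
  have "continuous_on (sphere 0 1) f"
    unfolding f_def
    by (intro continuous_intros matrix_vector_mult_linear_continuous_on)
      (metis Zpos less_irrefl mem_sphere_0 norm_zero zero_neq_one)
  moreover have "sphere (0::real^'n) 1 \<noteq> {}"
    by simp
  ultimately obtain v where v: "v \<in> sphere 0 1" and vmin: "\<And>u. u \<in> sphere 0 1 \<Longrightarrow> f v \<le> f u"
    using continuous_attains_inf[of "sphere 0 1" f] by auto
  have v0: "v \<noteq> 0" using v by auto
  define l where "l = f v"
  have ge: "l * (u \<bullet> (Z *v u)) \<le> u \<bullet> (X *v u)" for u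
  proof (cases "u = 0")
    case False
    have "f u = f ((1 / norm u) *\<^sub>R u)"
      using False by (simp add: f_def matrix_vector_mult_scaleR)
    then have "l \<le> f u" using vmin[of "(1 / norm u) *\<^sub>R u"] False by (simp add: l_def)
    then show ?thesis using Zpos[OF False] by (simp add: f_def field_simps)
  qed simp
  define D where "D = X - l *\<^sub>R Z"
  have D: "D *v u = X *v u - l *\<^sub>R (Z *v u)" for u
    by (simp add: D_def matrix_vector_mult_diff_rdistrib scaleR_matrix_vector_mult)
  have "symmetric_matrix D"
    using X Z unfolding D_def pos_definite_def symmetric_matrix_def transpose_def
    by (simp add: vec_eq_iff)
  then have "D *v v = 0"
    by (rule psd_null_vector) (use ge Zpos[OF v0] in \<open>auto simp: D inner_diff_right l_def f_def\<close>)
  then have "X *v v = l *\<^sub>R (Z *v v)" by (simp add: D)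
  then have "l * (v \<bullet> (A *v (Z *v v))) < 0"
    using AX[OF v0] by (simp add: matrix_vector_mult_scaleR)
  then have "0 < l" using AZ[OF v0] by (simp add: mult_less_0_iff)
  then have "0 < u \<bullet> (X *v u)" if "u \<noteq> 0" for u
    using ge[of u] Zpos[OF that] by (smt (verit) mult_pos_pos)
  then show ?thesis using X by (simp add: pos_definite_def)
qed

text \<open>Strict negativity is uniform by compactness of the sphere. This margin turns \<open>\<le> \<gamma>\<close> into the
  required \<open>< \<gamma>\<close>, and it is what small perturbations may use up.\<close>
lemma negative_quadratic_bound:
  fixes f :: "'a::euclidean_space \<Rightarrow> real"
  assumes "continuous_on UNIV f" and hom: "\<And>c x. f (c *\<^sub>R x) = c\<^sup>2 * f x"
    and neg: "\<And>x. x \<noteq> 0 \<Longrightarrow> f x < 0"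
  shows "\<exists>d>0. \<forall>x. f x \<le> - d * (norm x)\<^sup>2"
proof -
  obtain b :: 'a where "norm b = 1" using vector_choose_size[of 1] by auto
  then have "sphere (0::'a) 1 \<noteq> {}" by (auto simp: sphere_def dist_norm)
  then obtain v where v: "v \<in> sphere 0 1" and vmax: "\<And>u. u \<in> sphere 0 1 \<Longrightarrow> f u \<le> f v"
    using continuous_attains_sup[of "sphere 0 1" f] continuous_on_subset[OF assms(1)] by auto
  have "f x \<le> - (- f v) * (norm x)\<^sup>2" for x
  proof (cases "x = 0")
    case True
    then show ?thesis using hom[of 0 0] by simp
  next
    case False
    have "f x = (norm x)\<^sup>2 * f ((1 / norm x) *\<^sub>R x)"
      using False by (simp add: hom power_divide)
    also have "\<dots> \<le> (norm x)\<^sup>2 * f v"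
      using vmax[of "(1 / norm x) *\<^sub>R x"] False by (intro mult_left_mono) auto
    finally show ?thesis by (simp add: mult.commute)
  qed
  moreover have "0 < - f v" using neg[of v] v by (cases "v = 0") auto
  ultimately show ?thesis by blast
qed

section \<open>Stability and frequency response from a dissipation inequality\<close>

definition re_vec :: "complex^'n \<Rightarrow> real^'n" where "re_vec v = (\<chi> i. Re (v $ i))"
definition im_vec :: "complex^'n \<Rightarrow> real^'n" where "im_vec v = (\<chi> i. Im (v $ i))"

lemma re_im_vec_cmat [simp]:
  "re_vec (cmat A *v v) = A *v re_vec v" "im_vec (cmat A *v v) = A *v im_vec v"
  by (simp_all add: re_vec_def im_vec_def cmat_def matrix_vector_mult_def vec_eq_iff)

lemma re_im_vec_add [simp]:
  "re_vec (u + v) = re_vec u + re_vec v" "im_vec (u + v) = im_vec u + im_vec v"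
  by (simp_all add: re_vec_def im_vec_def vec_eq_iff)

lemma re_im_vec_scale:
  "re_vec (l *s v) = Re l *\<^sub>R re_vec v - Im l *\<^sub>R im_vec v"
  "im_vec (l *s v) = Re l *\<^sub>R im_vec v + Im l *\<^sub>R re_vec v"
  by (simp_all add: re_vec_def im_vec_def vec_eq_iff)

lemma re_im_vec_eq_0: "re_vec v = 0 \<Longrightarrow> im_vec v = 0 \<Longrightarrow> v = 0"
  by (simp add: re_vec_def im_vec_def vec_eq_iff complex_eq_iff)

lemma norm_re_im_vec: "(norm v)\<^sup>2 = (norm (re_vec v))\<^sup>2 + (norm (im_vec v))\<^sup>2"
  by (simp add: norm_vec_def L2_set_def sum_nonneg re_vec_def im_vec_def cmod_power2
      sum.distrib real_norm_def)

text \<open>For an eigenvector \<open>a + ib\<close>, the real form added up at \<open>a\<close> and at \<open>b\<close> is \<open>Re l\<close> times the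
  positive number \<open>a\<cdot>Pa + b\<cdot>Pb\<close>; the terms with \<open>Im l\<close> cancel because \<open>P\<close> is symmetric.\<close>
lemma lyapunov_hurwitz:
  fixes A P :: "real^'n^'n"
  assumes P: "pos_definite P" and neg: "\<And>x. x \<noteq> 0 \<Longrightarrow> (P *v x) \<bullet> (A *v x) < 0"
  shows "hurwitz A"
  unfolding hurwitz_def
proof (intro allI impI)
  fix l v assume "v \<noteq> 0 \<and> cmat A *v v = l *s v"
  then have v: "v \<noteq> 0" and ev: "cmat A *v v = l *s v" by auto
  define a b where "a = re_vec v" and "b = im_vec v"
  have ab: "a \<noteq> 0 \<or> b \<noteq> 0" using v re_im_vec_eq_0 by (auto simp: a_def b_def)
  have Aa: "A *v a = Re l *\<^sub>R a - Im l *\<^sub>R b" and Ab: "A *v b = Re l *\<^sub>R b + Im l *\<^sub>R a"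
    using arg_cong[OF ev, of re_vec] arg_cong[OF ev, of im_vec] by (simp_all add: re_im_vec_scale a_def b_def)
  have sym: "(P *v a) \<bullet> b = (P *v b) \<bullet> a"
    using P symmetric_matrix_inner[of P a b] by (simp add: pos_definite_def inner_commute)
  have n: "(P *v x) \<bullet> (A *v x) \<le> 0" for x using neg[of x] by (cases "x = 0") auto
  have p: "0 \<le> x \<bullet> (P *v x)" for x using P by (cases "x = 0") (auto simp: pos_definite_def less_imp_le)
  have "(P *v a) \<bullet> (A *v a) + (P *v b) \<bullet> (A *v b) < 0"
    using ab
  proof
    assume "a \<noteq> 0"
    then show ?thesis using neg[of a] n[of b] by linarith
  next
    assume "b \<noteq> 0"
    then show ?thesis using neg[of b] n[of a] by linarith
  qed
  moreover have "(P *v a) \<bullet> (A *v a) + (P *v b) \<bullet> (A *v b) = Re l * (a \<bullet> (P *v a) + b \<bullet> (P *v b))"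
    using sym by (simp add: Aa Ab inner_diff_right inner_add_right inner_commute algebra_simps)
  ultimately show "Re l < 0"
    using p[of a] p[of b] by (simp add: mult_less_0_iff)
qed

lemma mat_mult_vector: "mat (c::'a::semiring_1) *v x = c *s x"
proof -
  have "(if i = j then c else 0) * x $ j = (if i = j then c * x $ j else 0)" for i j
    by simp
  then show ?thesis
    by (simp add: matrix_vector_mult_def mat_def vec_eq_iff)
qed

text \<open>The response \<open>x\<close> to a sinusoid satisfies \<open>Ax + Bw = i\<omega>x\<close>. At the real and imaginary parts of
  \<open>x\<close> the left-hand sides of the dissipation inequality add up to zero, since the stored energy
  does not change over a period.\<close>
lemma hinf_norm_le:
  fixes A P :: "real^'n^'n" and B :: "real^'w^'n" and C :: "real^'n^'z"
  assumes A: "hurwitz A" and P: "symmetric_matrix P" and g: "0 \<le> g"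
    and diss: "\<And>x w. 2 * ((P *v x) \<bullet> (A *v x + B *v w)) \<le> c * (g\<^sup>2 * (norm w)\<^sup>2 - (norm (C *v x + D *v w))\<^sup>2)"
    and c: "0 < c"
  shows "hinf_norm A B C D \<le> ereal g"
  unfolding hinf_norm_def
proof (rule SUP_least)
  fix \<omega> :: real
  define s where "s = \<i> * complex_of_real \<omega>"
  have Re_s: "Re s = 0" and Im_s: "Im s = \<omega>" by (simp_all add: s_def)
  have "x = 0" if "(mat s - cmat A) *v x = 0" for x
  proof (rule ccontr)
    assume "x \<noteq> 0"
    moreover have "cmat A *v x = s *s x"
      using that by (simp add: matrix_vector_mult_diff_rdistrib mat_mult_vector)
    ultimately have "Re s < 0" using A unfolding hurwitz_def by blast
    then show False using Re_s by simp
  qed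
  then have "invertible (mat s - cmat A)"
    unfolding invertible_left_inverse matrix_left_invertible_ker by blast
  note inv = matrix_inv_mult(1)[OF this]
  have "norm (transfer_function A B C D s *v v) \<le> g * norm v" for v
  proof -
    define x where "x = matrix_inv (mat s - cmat A) *v (cmat B *v v)"
    have "(mat s - cmat A) *v x = cmat B *v v"
      by (simp add: x_def matrix_vector_mul_assoc matrix_mul_assoc inv)
    then have eq: "s *s x = cmat A *v x + cmat B *v v"
      by (simp add: matrix_vector_mult_diff_rdistrib mat_mult_vector algebra_simps)
    have tf: "transfer_function A B C D s *v v = cmat C *v x + cmat D *v v"
      by (simp add: transfer_function_def x_def matrix_vector_mult_add_rdistrib
          matrix_vector_mul_assoc[symmetric] add.commute)
    define y where "y = cmat C *v x + cmat D *v v"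
    have "re_vec (s *s x) = A *v re_vec x + B *v re_vec v" 
      and "im_vec (s *s x) = A *v im_vec x + B *v im_vec v"
      unfolding eq by simp_all
    then have r: "A *v re_vec x + B *v re_vec v = - \<omega> *\<^sub>R im_vec x"
      and i: "A *v im_vec x + B *v im_vec v = \<omega> *\<^sub>R re_vec x"
      unfolding re_im_vec_scale Re_s Im_s by simp_all
    have "(P *v re_vec x) \<bullet> (- \<omega> *\<^sub>R im_vec x) + (P *v im_vec x) \<bullet> (\<omega> *\<^sub>R re_vec x) = 0"
      using symmetric_matrix_inner[OF P, of "im_vec x" "re_vec x"] by (simp add: inner_commute)
    moreover have "re_vec y = C *v re_vec x + D *v re_vec v" "im_vec y = C *v im_vec x + D *v im_vec v"
      by (simp_all add: y_def)
    ultimately have "0 \<le> c * (g\<^sup>2 * (norm (re_vec v))\<^sup>2 - (norm (re_vec y))\<^sup>2)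
        + c * (g\<^sup>2 * (norm (im_vec v))\<^sup>2 - (norm (im_vec y))\<^sup>2)"
      using diss[of "re_vec x" "re_vec v"] diss[of "im_vec x" "im_vec v"] 
      unfolding r i by (smt (verit))
    also have "\<dots> = c * (g\<^sup>2 * (norm v)\<^sup>2 - (norm y)\<^sup>2)"
      unfolding norm_re_im_vec[of v] norm_re_im_vec[of y] by (simp add: algebra_simps)
    finally have "0 \<le> g\<^sup>2 * (norm v)\<^sup>2 - (norm y)\<^sup>2"
      using c by (simp add: zero_le_mult_iff)
    then have "(norm y)\<^sup>2 \<le> (g * norm v)\<^sup>2"
      by (simp add: power_mult_distrib)
    then have "norm y \<le> g * norm v"
      by (rule power2_le_imp_le) (simp add: g)
    then show ?thesis by (simp only: tf y_def)
  qed
  then show "ereal (onorm ((*v) (transfer_function A B C D (\<i> * complex_of_real \<omega>)))) \<le> ereal g"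
    by (simp add: onorm_bound g s_def)
qed

section \<open>Storage functions along trajectories\<close>

text \<open>Both increments are additive over subdivisions, so a bound on short intervals suffices.\<close>
lemma increment_bound_from_local:
  fixes h \<phi> :: "real \<Rightarrow> real"
  assumes d: "0 < d"
    and loc: "\<And>s t. a \<le> s \<Longrightarrow> s \<le> t \<Longrightarrow> t \<le> b \<Longrightarrow> t - s \<le> d \<Longrightarrow> \<bar>h t - h s\<bar> \<le> \<phi> t - \<phi> s"
    and ab: "a \<le> b"
  shows "\<bar>h b - h a\<bar> \<le> \<phi> b - \<phi> a"
proof -
  have "\<bar>h t - h a\<bar> \<le> \<phi> t - \<phi> a" if "a \<le> t" "t \<le> b" "t - a \<le> real n * d" for t n
    using that
  proof (induction n arbitrary: t)
    case 0
    then show ?case by simp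
  next
    case (Suc n)
    define s where "s = max a (t - d)"
    have "\<bar>h s - h a\<bar> \<le> \<phi> s - \<phi> a"
      using Suc.prems d by (intro Suc.IH) (auto simp: s_def algebra_simps)
    moreover have "\<bar>h t - h s\<bar> \<le> \<phi> t - \<phi> s"
      using Suc.prems d by (intro loc) (auto simp: s_def)
    ultimately show ?case by linarith
  qed
  moreover obtain n where "b - a \<le> real n * d"
    using d reals_Archimedean3 less_imp_le by blast
  ultimately show ?thesis using ab by blast
qed

text \<open>The chain rule for \<open>x\<cdot>Px\<close> along an indefinite integral \<open>x\<close> of an integrable \<open>f\<close>. On a short
  interval \<open>[s, t]\<close> the exact increment is \<open>\<integral> P(x(t) + x(s))\<cdot>f\<close>, which differs from
  \<open>\<integral> 2 Px\<cdot>f\<close> by at most a constant times the oscillation of \<open>x\<close> times \<open>\<integral> \<parallel>f\<parallel>\<close>. The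
  oscillation is uniformly small on short intervals, and the errors add up to a multiple of the
  total \<open>\<integral> \<parallel>f\<parallel>\<close>.\<close>
lemma quadratic_form_increment:
  fixes f x :: "real \<Rightarrow> real^'n" and P :: "real^'n^'n"
  assumes P: "symmetric_matrix P" and f: "f absolutely_integrable_on {a..b}" and ab: "a \<le> b"
    and x: "\<And>t. t \<in> {a..b} \<Longrightarrow> x t = x a + integral {a..t} f"
  shows "(\<lambda>s. 2 * ((P *v x s) \<bullet> f s)) absolutely_integrable_on {a..b}"
    and "integral {a..b} (\<lambda>s. 2 * ((P *v x s) \<bullet> f s)) = x b \<bullet> (P *v x b) - x a \<bullet> (P *v x a)"
proof -
  define g where "g = (\<lambda>s. 2 * ((P *v x s) \<bullet> f s))"
  have fi: "f integrable_on {a..b}"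
    using f by (simp add: absolutely_integrable_on_def)
  have "continuous_on {a..b} (\<lambda>t. x a + integral {a..t} f)"
    by (intro continuous_intros indefinite_integral_continuous_1 fi)
  then have xc: "continuous_on {a..b} x"
    by (rule continuous_on_eq) (rule x[symmetric])
  have Pxc: "continuous_on {a..b} (\<lambda>s. P *v x s)"
    by (rule continuous_on_compose2[OF matrix_vector_mult_linear_continuous_on[of UNIV] xc]) auto
  have "(\<lambda>s. (P *v x s) \<bullet> f s) absolutely_integrable_on {a..b}"
  proof (rule absolutely_integrable_bounded_measurable_product[where h = "(\<bullet>)" and f = "\<lambda>s. P *v x s"])
    show "bilinear ((\<bullet>) :: real^'n \<Rightarrow> real^'n \<Rightarrow> real)"
      by (simp add: bilinear_def linear_iff inner_add_left inner_add_right)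
    show "(\<lambda>s. P *v x s) \<in> borel_measurable (lebesgue_on {a..b})"
      by (rule continuous_imp_measurable_on_sets_lebesgue[OF Pxc]) simp
    show "bounded ((\<lambda>s. P *v x s) ` {a..b})"
      by (rule compact_imp_bounded[OF compact_continuous_image[OF Pxc compact_Icc]])
  qed (use f in auto)
  from absolutely_integrable_scaleR_left[OF this, of 2]
  show ga: "(\<lambda>s. 2 * ((P *v x s) \<bullet> f s)) absolutely_integrable_on {a..b}"
    by simp
  then have gi: "g integrable_on {a..b}"
    by (simp add: absolutely_integrable_on_def g_def)
  have nfi: "(\<lambda>s. norm (f s)) integrable_on {a..b}"
    using f by (simp add: absolutely_integrable_on_def)
  obtain k where k: "0 < k" "\<And>v. norm (P *v v) \<le> norm v * k"
    using bounded_linear.pos_bounded[OF matrix_vector_mul_bounded_linear[of P]] by blast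
  define V where "V = (\<lambda>t. x t \<bullet> (P *v x t))"
  define h where "h = (\<lambda>t. V t - integral {a..t} g)"
  define \<Phi> where "\<Phi> = (\<lambda>t. integral {a..t} (\<lambda>s. norm (f s)))"
  have small: "\<bar>h b - h a\<bar> \<le> e * \<Phi> b" if e: "0 < e" for e
  proof -
    define \<eta> where "\<eta> = e / (2 * k)"
    have \<eta>: "0 < \<eta>" using e k by (simp add: \<eta>_def)
    have "uniformly_continuous_on {a..b} x"
      by (rule compact_uniformly_continuous[OF xc compact_Icc])
    then obtain d where d: "0 < d" 
      and dx: "\<And>s t. s \<in> {a..b} \<Longrightarrow> t \<in> {a..b} \<Longrightarrow> dist t s < d \<Longrightarrow> dist (x t) (x s) < \<eta>"
      using \<eta> unfolding uniformly_continuous_on_def by blast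
    have "\<bar>h b - h a\<bar> \<le> e * \<Phi> b - e * \<Phi> a"
    proof (rule increment_bound_from_local[where d = "d/2"])
      fix s t assume st: "a \<le> s" "s \<le> t" "t \<le> b" "t - s \<le> d / 2"
      have sub: "{s..t} \<subseteq> {a..b}" using st by auto
      have fst: "f integrable_on {s..t}" and gst: "g integrable_on {s..t}"
        and nfst: "(\<lambda>u. norm (f u)) integrable_on {s..t}"
        using integrable_subinterval_real[OF _ sub] fi gi nfi by auto
      have at: "{a..t} \<subseteq> {a..b}" using st by auto
      have fat: "f integrable_on {a..t}" and gat: "g integrable_on {a..t}"
        and nfat: "(\<lambda>u. norm (f u)) integrable_on {a..t}"
        using integrable_subinterval_real[OF _ at] fi gi nfi by auto
      have cf: "integral {a..t} f = integral {a..s} f + integral {s..t} f"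
        and cg: "integral {a..t} g = integral {a..s} g + integral {s..t} g"
        and cn: "\<Phi> t = \<Phi> s + integral {s..t} (\<lambda>u. norm (f u))"
        unfolding \<Phi>_def
        by (rule Henstock_Kurzweil_Integration.integral_combine[OF st(1,2), symmetric], fact)+
      have dxst: "x t - x s = integral {s..t} f"
        using x[of t] x[of s] st cf by simp
      define c where "c = P *v (x t + x s)"
      have "V t - V s = c \<bullet> (x t - x s)"
        using symmetric_matrix_inner[OF P, of "x t" "x s"]
        by (simp add: V_def c_def matrix_vector_right_distrib inner_add_left inner_diff_right
            inner_commute[of "P *v _"])
      also have "\<dots> = integral {s..t} (\<lambda>u. c \<bullet> f u)"
        unfolding dxst using integral_linear[OF fst bounded_linear_inner_right[of c]] by (simp add: o_def)
      finally have "h t - h s = integral {s..t} (\<lambda>u. c \<bullet> f u) - integral {s..t} g"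
        unfolding h_def cg by simp
      also have "\<dots> = integral {s..t} (\<lambda>u. c \<bullet> f u - g u)"
        using integrable_linear[OF fst bounded_linear_inner_right[of c]] gst
        by (simp add: integral_diff o_def)
      finally have E: "h t - h s = integral {s..t} (\<lambda>u. c \<bullet> f u - g u)" .
      have "norm (integral {s..t} (\<lambda>u. c \<bullet> f u - g u)) \<le> integral {s..t} (\<lambda>u. e * norm (f u))"
      proof (rule integral_norm_bound_integral)
        show "(\<lambda>u. c \<bullet> f u - g u) integrable_on {s..t}"
          using integrable_linear[OF fst bounded_linear_inner_right[of c]] gst
          by (intro integrable_diff) (simp_all add: o_def)
        show "(\<lambda>u. e * norm (f u)) integrable_on {s..t}"
          using nfst by (rule integrable_on_mult_right)
        fix u assume u: "u \<in> {s..t}"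
        have "dist (x t) (x u) < \<eta>" "dist (x s) (x u) < \<eta>"
          using u st d by (auto intro!: dx simp: dist_real_def)
        then have "norm (x t - x u) + norm (x s - x u) \<le> 2 * \<eta>"
          by (simp add: dist_norm)
        then have n: "norm ((x t - x u) + (x s - x u)) \<le> 2 * \<eta>"
          using norm_triangle_ineq[of "x t - x u" "x s - x u"] by linarith
        have "(x t - x u) + (x s - x u) = (x t + x s) - 2 *\<^sub>R x u"
          by (simp add: scaleR_2)
        then have "c \<bullet> f u - g u = (P *v ((x t - x u) + (x s - x u))) \<bullet> f u"
          by (simp only: c_def g_def matrix_vector_mult_diff_distrib inner_diff_left
              matrix_vector_mult_scaleR inner_scaleR_left)
        also have "norm \<dots> \<le> norm (P *v ((x t - x u) + (x s - x u))) * norm (f u)"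
          by (simp add: Cauchy_Schwarz_ineq2)
        also have "\<dots> \<le> (2 * \<eta> * k) * norm (f u)"
          using k n by (intro mult_right_mono order_trans[OF k(2)]) auto
        also have "2 * \<eta> * k = e" using k by (simp add: \<eta>_def)
        finally show "norm (c \<bullet> f u - g u) \<le> e * norm (f u)" .
      qed
      then show "\<bar>h t - h s\<bar> \<le> e * \<Phi> t - e * \<Phi> s"
        unfolding E cn by (simp add: algebra_simps)
    qed (use d ab in auto)
    then show ?thesis by (simp add: \<Phi>_def)
  qed
  have "\<bar>h b - h a\<bar> \<le> 0"
  proof (rule field_le_epsilon)
    fix e :: real assume e: "0 < e"
    have "0 \<le> \<Phi> b" unfolding \<Phi>_def by (rule integral_nonneg[OF nfi]) simp
    then have "e / (\<Phi> b + 1) * \<Phi> b \<le> e" "0 < e / (\<Phi> b + 1)"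
      using e by (simp_all add: field_simps)
    then show "\<bar>h b - h a\<bar> \<le> 0 + e" using small[of "e / (\<Phi> b + 1)"] by linarith
  qed
  then show "integral {a..b} (\<lambda>s. 2 * ((P *v x s) \<bullet> f s)) = x b \<bullet> (P *v x b) - x a \<bullet> (P *v x a)"
    by (simp add: h_def V_def g_def)
qed

lemma trajectory_facts:
  fixes A P :: "real^'n^'n" and B :: "real^'w^'n"
  assumes P: "symmetric_matrix P" and tr: "zero_state_trajectory A B w x"
    and w: "w absolutely_integrable_on {0..T}" and ab: "0 \<le> a" "a \<le> b" "b \<le> T"
  shows "continuous_on {0..T} x"
    and "(\<lambda>s. 2 * ((P *v x s) \<bullet> (A *v x s + B *v w s))) integrable_on {a..b}"
    and "integral {a..b} (\<lambda>s. 2 * ((P *v x s) \<bullet> (A *v x s + B *v w s))) =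
           x b \<bullet> (P *v x b) - x a \<bullet> (P *v x a)"
proof -
  define f where "f = (\<lambda>s. A *v x s + B *v w s)"
  have T: "0 \<le> T" using ab by simp
  have hi: "(f has_integral x t) {0..t}" if "0 \<le> t" for t
    using tr that by (simp add: zero_state_trajectory_def f_def)
  have xi: "x t = integral {0..t} f" if "0 \<le> t" for t
    using hi[OF that] by (simp add: integral_unique)
  have fi: "f integrable_on {0..T}" using hi[OF T] by blast
  show xc: "continuous_on {0..T} x"
    by (rule continuous_on_eq[OF indefinite_integral_continuous_1[OF fi]]) (simp add: xi)
  have "(\<lambda>s. A *v x s) absolutely_integrable_on {0..T}"
    by (intro absolutely_integrable_continuous_real
        continuous_on_compose2[OF matrix_vector_mult_linear_continuous_on[of UNIV] xc]) auto
  moreover have "(\<lambda>s. B *v w s) absolutely_integrable_on {0..T}"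
    using absolutely_integrable_linear[OF w matrix_vector_mul_bounded_linear[of B]] by (simp add: o_def)
  ultimately have "f absolutely_integrable_on {0..T}"
    unfolding f_def by (rule set_integral_add)
  then have fab: "f absolutely_integrable_on {a..b}"
    by (rule absolutely_integrable_on_subinterval) (use ab in auto)
  have x: "x t = x a + integral {a..t} f" if "t \<in> {a..b}" for t
    using Henstock_Kurzweil_Integration.integral_combine[of 0 a t f] hi[of t] xi[of t] xi[of a] that ab
    by (auto simp: has_integral_iff)
  note * = quadratic_form_increment[OF P fab ab(2) x]
  show "(\<lambda>s. 2 * ((P *v x s) \<bullet> (A *v x s + B *v w s))) integrable_on {a..b}"
    using *(1) by (simp add: absolutely_integrable_on_def f_def)
  show "integral {a..b} (\<lambda>s. 2 * ((P *v x s) \<bullet> (A *v x s + B *v w s))) =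
           x b \<bullet> (P *v x b) - x a \<bullet> (P *v x a)"
    using *(2) by (simp add: f_def)
qed

text \<open>If the storage exceeded \<open>r\<close> at time \<open>t\<close>, it would stay above \<open>r\<close> since the last time \<open>a\<close> at
  which it was at most \<open>r\<close>. But there its rate of change is at most \<open>\<alpha> (\<parallel>w\<parallel>\<^sup>2 - r) \<le> 0\<close>.\<close>
lemma reachable_ellipsoid:
  fixes A P :: "real^'n^'n" and B :: "real^'w^'n"
  assumes P: "symmetric_matrix P" and tr: "zero_state_trajectory A B w x"
    and w: "w \<in> borel_measurable (lebesgue_on {0..})" and wb: "\<And>t. 0 \<le> t \<Longrightarrow> w t \<bullet> w t \<le> r"
    and \<alpha>: "0 < \<alpha>"
    and diss: "\<And>x w. 2 * ((P *v x) \<bullet> (A *v x + B *v w)) \<le> \<alpha> * (w \<bullet> w) - \<alpha> * (x \<bullet> (P *v x))"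
    and t: "0 \<le> t"
  shows "x t \<bullet> (P *v x t) \<le> r"
proof (rule ccontr)
  define V where "V = (\<lambda>t. x t \<bullet> (P *v x t))"
  assume "\<not> x t \<bullet> (P *v x t) \<le> r"
  then have Vt: "r < V t" by (simp add: V_def)
  have "w absolutely_integrable_on {0..t}"
  proof (rule measurable_bounded_by_integrable_imp_absolutely_integrable)
    show "w \<in> borel_measurable (lebesgue_on {0..t})"
      by (rule measurable_restrict_mono[OF w]) auto
    show "(\<lambda>_. sqrt r) integrable_on {0..t}" by (rule integrable_const_ivl)
    show "norm (w s) \<le> sqrt r" if "s \<in> {0..t}" for s
      using wb[of s] that by (simp add: norm_eq_sqrt_inner)
  qed auto
  note traj = trajectory_facts[OF P tr this]
  have xc: "continuous_on {0..t} x" using traj(1)[of t t] t by simp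
  have Vc: "continuous_on {0..t} V"
    unfolding V_def
    by (intro continuous_intros xc continuous_on_compose2[OF matrix_vector_mult_linear_continuous_on[of UNIV] xc]) auto
  have r0: "0 \<le> r" using wb[of 0] inner_ge_zero[of "w 0"] by linarith
  have V0: "V 0 = 0" using tr by (simp add: V_def zero_state_trajectory_def)
  define S where "S = {s \<in> {0..t}. V s \<le> r}"
  have "closed S"
    unfolding S_def
    by (rule continuous_on_closed_Collect_le[OF Vc continuous_on_const closed_atLeastAtMost])
  moreover have "bounded S"
    by (rule bounded_subset[of "{0..t}"]) (auto simp: S_def)
  ultimately have "compact S" by (simp add: compact_eq_bounded_closed)
  moreover have "S \<noteq> {}" using V0 r0 t by (auto simp: S_def)
  ultimately obtain a where a: "a \<in> S" and amax: "\<And>s. s \<in> S \<Longrightarrow> s \<le> a"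
    using compact_attains_sup by metis
  have at: "0 \<le> a" "a \<le> t" "V a \<le> r" using a by (auto simp: S_def)
  have above: "r \<le> V s" if s: "s \<in> {a..t}" for s
  proof (rule ccontr)
    assume "\<not> r \<le> V s"
    moreover have "continuous_on {s..t} V"
      by (rule continuous_on_subset[OF Vc]) (use s at in auto)
    ultimately obtain u where u: "s \<le> u" "u \<le> t" "V u = r"
      using IVT'[of V s r t] s Vt by auto
    then have "u \<in> S" using s at by (auto simp: S_def)
    then have "u = s" using amax[of u] u s by auto
    then show False using \<open>\<not> r \<le> V s\<close> u by simp
  qed
  have "integral {a..t} (\<lambda>s. 2 * ((P *v x s) \<bullet> (A *v x s + B *v w s))) \<le> integral {a..t} (\<lambda>s. 0)"
  proof (rule integral_le)
    show "(\<lambda>s. 2 * ((P *v x s) \<bullet> (A *v x s + B *v w s))) integrable_on {a..t}"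
      by (rule traj(2)) (use at in auto)
    fix s assume s: "s \<in> {a..t}"
    have "\<alpha> * (w s \<bullet> w s) \<le> \<alpha> * V s"
      using above[OF s] wb[of s] s at \<alpha> by (intro mult_left_mono) auto
    then show "2 * ((P *v x s) \<bullet> (A *v x s + B *v w s)) \<le> 0"
      using diss[of "x s" "w s"] by (simp add: V_def)
  qed (rule integrable_0)
  moreover have "integral {a..t} (\<lambda>s. 2 * ((P *v x s) \<bullet> (A *v x s + B *v w s))) = V t - V a"
    unfolding V_def by (rule traj(3)) (use at in auto)
  ultimately have "V t - V a \<le> 0" by (simp only: integral_0)
  then show False using Vt at(3) by linarith
qed

section \<open>The energy gain\<close>

lemma energy_le_of_truncations:
  assumes F: "F \<in> borel_measurable (lebesgue_on {0..})"
    and le: "\<And>T. 0 \<le> T \<Longrightarrow> (\<integral>\<^sup>+ t. F t \<partial>lebesgue_on {0..T::real}) \<le> c"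
  shows "(\<integral>\<^sup>+ t. F t \<partial>lebesgue_on {0..}) \<le> c"
proof -
  define G where "G = (\<lambda>n t. F t * indicator {0..real n} t)"
  have "(\<integral>\<^sup>+ t. F t \<partial>lebesgue_on {0..}) = (\<integral>\<^sup>+ t. (SUP n. G n t) \<partial>lebesgue_on {0..})"
  proof (rule nn_integral_cong)
    fix t assume "t \<in> space (lebesgue_on {0::real..})"
    then have t: "0 \<le> t" by simp
    obtain n where "t \<le> real n" using real_arch_simple by blast
    then have "G n t = F t" using t by (simp add: G_def)
    moreover have "G m t \<le> F t" for m by (simp add: G_def indicator_def)
    ultimately show "F t = (SUP n. G n t)"
      by (intro antisym SUP_least) (metis SUP_upper UNIV_I, auto)
  qed
  also have "\<dots> = (SUP n. \<integral>\<^sup>+ t. G n t \<partial>lebesgue_on {0..})"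
  proof (rule nn_integral_monotone_convergence_SUP)
    show "incseq G"
      by (auto simp: G_def incseq_def le_fun_def indicator_def)
    show "G n \<in> borel_measurable (lebesgue_on {0..})" for n
      unfolding G_def
      by (intro borel_measurable_times_ennreal F borel_measurable_indicator)
        (simp add: sets_restrict_space_iff)
  qed
  also have "\<dots> \<le> c"
  proof (rule SUP_least)
    fix n
    have "(\<integral>\<^sup>+ t. G n t \<partial>lebesgue_on {0..}) = (\<integral>\<^sup>+ t. F t \<partial>lebesgue_on {0..real n})"
      by (simp add: nn_integral_restrict_space G_def) (auto intro!: nn_integral_cong simp: indicator_def)
    then show "(\<integral>\<^sup>+ t. G n t \<partial>lebesgue_on {0..}) \<le> c" using le[of "real n"] by simp
  qed
  finally show ?thesis .
qed

text \<open>Integrating the dissipation inequality over \<open>[0, T]\<close> compares the truncated energies, because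
  the storage starts at zero and ends nonnegative.\<close>
lemma energy_gain_bound:
  fixes A P :: "real^'n^'n" and B :: "real^'w^'n" and C :: "real^'n^'z"
  assumes P: "symmetric_matrix P" and psd: "\<And>x. 0 \<le> x \<bullet> (P *v x)"
    and tr: "zero_state_trajectory A B w x"
    and w: "w \<in> borel_measurable (lebesgue_on {0..})" and fin: "energy w < \<infinity>"
    and diss: "\<And>x w. 2 * ((P *v x) \<bullet> (A *v x + B *v w)) \<le> c * (g\<^sup>2 * (norm w)\<^sup>2 - (norm (C *v x + D *v w))\<^sup>2)"
    and c: "0 < c"
  shows "energy (\<lambda>t. C *v x t + D *v w t) \<le> ennreal (g\<^sup>2) * energy w"
proof -
  define y where "y = (\<lambda>t. C *v x t + D *v w t)"
  have meas_mult: "(\<lambda>t. M *v f t) \<in> borel_measurable N" if "f \<in> borel_measurable N"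
    for M :: "real^'k^'l" and f and N :: "real measure"
    by (rule measurable_compose[OF that borel_measurable_continuous_onI[OF matrix_vector_mult_linear_continuous_on]])
  \<comment> \<open>Finite energy makes the disturbance integrable on bounded intervals.\<close>
  have trunc: "(\<lambda>t. (norm (w t))\<^sup>2) integrable_on {0..T} \<and> w absolutely_integrable_on {0..T} \<and>
      (\<integral>\<^sup>+ t. ennreal ((norm (w t))\<^sup>2) \<partial>lebesgue_on {0..T}) = ennreal (integral {0..T} (\<lambda>t. (norm (w t))\<^sup>2)) \<and>
      (\<integral>\<^sup>+ t. ennreal ((norm (w t))\<^sup>2) \<partial>lebesgue_on {0..T}) \<le> energy w"
    if T: "0 \<le> T" for T
  proof -
    have wT: "w \<in> borel_measurable (lebesgue_on {0..T})"
      by (rule measurable_restrict_mono[OF w]) auto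
    have le: "(\<integral>\<^sup>+ t. ennreal ((norm (w t))\<^sup>2) \<partial>lebesgue_on {0..T}) \<le> energy w"
      unfolding energy_def
      by (simp add: nn_integral_restrict_space) (auto intro!: nn_integral_mono simp: indicator_def)
    have I: "integrable (lebesgue_on {0..T}) (\<lambda>t. (norm (w t))\<^sup>2)"
      by (rule integrableI_nonneg) (use wT le fin in \<open>auto intro: le_less_trans\<close>)
    have sq: "(\<lambda>t. (norm (w t))\<^sup>2) integrable_on {0..T}"
      by (rule integrable_on_lebesgue_on[OF I]) simp
    have "w absolutely_integrable_on {0..T}"
    proof (rule measurable_bounded_by_integrable_imp_absolutely_integrable[OF wT])
      show "(\<lambda>t. 1 + (norm (w t))\<^sup>2) integrable_on {0..T}"
        by (intro integrable_add sq integrable_const_ivl)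
      show "norm (w t) \<le> 1 + (norm (w t))\<^sup>2" for t
        using sum_power2_ge_zero[of "norm (w t) - 1" "norm (w t)"] by (simp add: power2_diff)
    qed simp
    moreover have "(\<integral>\<^sup>+ t. ennreal ((norm (w t))\<^sup>2) \<partial>lebesgue_on {0..T}) = ennreal (integral {0..T} (\<lambda>t. (norm (w t))\<^sup>2))"
      using nn_integral_eq_integral[OF I] lebesgue_integral_eq_integral[OF I] by simp
    ultimately show ?thesis using sq le by blast
  qed
  have ymeas: "y \<in> borel_measurable (lebesgue_on {0..T})" if T: "0 \<le> T" for T
  proof -
    have "w \<in> borel_measurable (lebesgue_on {0..T})"
      by (rule measurable_restrict_mono[OF w]) auto
    moreover have "x \<in> borel_measurable (lebesgue_on {0..T})"
      using trajectory_facts(1)[OF P tr _ order_refl T order_refl] trunc[OF T]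
      by (auto intro: continuous_imp_measurable_on_sets_lebesgue)
    ultimately show ?thesis
      unfolding y_def by (intro borel_measurable_add meas_mult)
  qed
  have bound: "(\<integral>\<^sup>+ t. ennreal ((norm (y t))\<^sup>2) \<partial>lebesgue_on {0..T}) \<le> ennreal (g\<^sup>2) * energy w"
    if T: "0 \<le> T" for T
  proof -
    define h where "h = (\<lambda>t. 2 * ((P *v x t) \<bullet> (A *v x t + B *v w t)))"
    define k where "k = 1 / c"
    have k: "0 < k" using c by (simp add: k_def)
    note tw = trunc[OF T]
    note traj = trajectory_facts[OF P tr _ order_refl T order_refl]
    have hi: "h integrable_on {0..T}" using traj(2) tw by (simp add: h_def)
    have V: "0 \<le> integral {0..T} h"
      using traj(3) tw psd[of "x T"] tr by (simp add: h_def zero_state_trajectory_def)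
    have Ri: "(\<lambda>t. g\<^sup>2 * (norm (w t))\<^sup>2 - k * h t) integrable_on {0..T}"
      using tw hi by (intro integrable_diff integrable_on_mult_right) auto
    have pt: "(norm (y t))\<^sup>2 \<le> g\<^sup>2 * (norm (w t))\<^sup>2 - k * h t" for t
      using diss[of "x t" "w t"] c by (simp add: h_def y_def k_def field_simps)
    have "(\<lambda>t. (norm (y t))\<^sup>2) absolutely_integrable_on {0..T}"
      by (rule measurable_bounded_by_integrable_imp_absolutely_integrable[OF _ _ Ri])
        (use ymeas[OF T] pt in auto)
    then have I: "integrable (lebesgue_on {0..T}) (\<lambda>t. (norm (y t))\<^sup>2)"
      by (simp add: integrable_restrict_space set_integrable_def)
    have "integral {0..T} (\<lambda>t. (norm (y t))\<^sup>2) \<le> integral {0..T} (\<lambda>t. g\<^sup>2 * (norm (w t))\<^sup>2 - k * h t)"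
      by (rule integral_le[OF integrable_on_lebesgue_on[OF I] Ri]) (use pt in auto)
    also have "\<dots> = g\<^sup>2 * integral {0..T} (\<lambda>t. (norm (w t))\<^sup>2) - k * integral {0..T} h"
      using tw hi by (subst integral_diff) (auto intro: integrable_on_mult_right)
    also have "\<dots> \<le> g\<^sup>2 * integral {0..T} (\<lambda>t. (norm (w t))\<^sup>2)"
      using V k by simp
    finally have le: "integral {0..T} (\<lambda>t. (norm (y t))\<^sup>2) \<le> g\<^sup>2 * integral {0..T} (\<lambda>t. (norm (w t))\<^sup>2)" .
    have "(\<integral>\<^sup>+ t. ennreal ((norm (y t))\<^sup>2) \<partial>lebesgue_on {0..T}) = ennreal (integral {0..T} (\<lambda>t. (norm (y t))\<^sup>2))"
      using nn_integral_eq_integral[OF I] lebesgue_integral_eq_integral[OF I] by simp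
    also have "\<dots> \<le> ennreal (g\<^sup>2 * integral {0..T} (\<lambda>t. (norm (w t))\<^sup>2))"
      using le by (rule ennreal_leI)
    also have "\<dots> = ennreal (g\<^sup>2) * (\<integral>\<^sup>+ t. ennreal ((norm (w t))\<^sup>2) \<partial>lebesgue_on {0..T})"
      using tw by (simp add: ennreal_mult' )
    also have "\<dots> \<le> ennreal (g\<^sup>2) * energy w"
      using tw by (intro mult_left_mono) auto
    finally show ?thesis .
  qed
  have "y \<in> borel_measurable (lebesgue_on {0..})"
  proof -
    have "continuous_on {0..} x"
    proof (rule continuous_on_eq_continuous_within[THEN iffD2], rule ballI)
      fix t :: real assume t: "t \<in> {0..}"
      have "continuous_on {0..t+1} x"
        using trajectory_facts(1)[OF P tr, of "t+1" 0 0] trunc[of "t+1"] t by auto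
      then have "continuous (at t within {0..t+1}) x"
        using t by (simp add: continuous_on_eq_continuous_within)
      moreover have "at t within {0..t+1} = at t within {0..}"
        using t by (intro at_within_nhd[of t "{t-1<..<t+1}"]) auto
      ultimately show "continuous (at t within {0..}) x" by simp
    qed
    then have "x \<in> borel_measurable (lebesgue_on {0..})"
      by (auto intro: continuous_imp_measurable_on_sets_lebesgue)
    then show ?thesis
      unfolding y_def by (intro borel_measurable_add meas_mult w)
  qed
  then have "(\<lambda>t. ennreal ((norm (y t))\<^sup>2)) \<in> borel_measurable (lebesgue_on {0..})"
    by measurable
  from energy_le_of_truncations[OF this bound]
  show ?thesis by (simp add: energy_def y_def)
qed

section \<open>Factoring the linearized blocks through the closed loop\<close>

text \<open>The defining identities of the change of variables. The compensator enters only through the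
  equations it has to solve, so that no inverse appears. The transposed products are also
  needed in the form \<open>v* H21\<close>, to which the simplifier reduces \<open>transpose H21 *v _\<close>.\<close>
lemma closed_loop_factorization:
  fixes A R V Y L G21 H21 Ac :: "real^'n^'n" and F Cc :: "real^'n^'u" and E Bc :: "real^'y^'n"
    and B1 :: "real^'w^'n" and C1 :: "real^'n^'z"
  assumes Y: "transpose Y = Y"
    and GH: "transpose G21 ** H21 = V - transpose R ** Y"
    and F: "Cc ** G21 = F" and E: "transpose H21 ** Bc = E"
    and L: "transpose H21 ** Ac ** G21 =
      L - transpose Y ** A ** R - E ** C2 ** R - transpose Y ** B2 ** F"
  defines "W \<equiv> vcat (mat 1 ||| 0) (Y ||| transpose H21)" and "U \<equiv> vcat (R ||| mat 1) (G21 ||| 0)"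
  shows "state_blk A B2 C2 R Y L E F = W ** A_cl A B2 C2 Ac Bc Cc ** U"
    and "slack_blk R V Y = W ** U"
    and "vcat B1 (transpose Y ** B1 + E ** D21) = W ** B_cl B1 D21 Bc"
    and "(C1 ** R + D12 ** F ||| C1) = C_cl C1 D12 Cc ** U"
    and "(F ||| 0) = (0 ||| Cc) ** U"
proof -
  have GH': "transpose H21 *v (G21 *v p) = transpose V *v p - Y *v (R *v p)" for p
  proof -
    have "transpose H21 ** G21 = transpose V - Y ** R"
      using arg_cong[OF GH, of transpose] Y 
      by (simp add: matrix_transpose_mul transpose_def vec_eq_iff matrix_matrix_mult_def mult.commute)
    then show ?thesis
      by (metis matrix_vector_mul_assoc matrix_vector_mult_diff_rdistrib)
  qed
  have F': "Cc *v (G21 *v p) = F *v p" for p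
    using F by (simp add: matrix_vector_mul_assoc)
  have E': "transpose H21 *v (Bc *v p) = E *v p" for p
    using E by (simp only: matrix_vector_mul_assoc)
  have L': "transpose H21 *v (Ac *v (G21 *v p)) = 
     L *v p - Y *v (A *v (R *v p)) - E *v (C2 *v (R *v p)) - Y *v (B2 *v (F *v p))" for p
  proof -
    have "transpose H21 *v (Ac *v (G21 *v p)) = (transpose H21 ** Ac ** G21) *v p"
      by (simp only: matrix_vector_mul_assoc matrix_mul_assoc)
    then show ?thesis unfolding L
      by (simp only: Y matrix_vector_mult_diff_rdistrib matrix_vector_mul_assoc[symmetric])
  qed
  note s = matrix_vector_mul_assoc[symmetric] matrix_vector_mult_add_rdistrib
    matrix_vector_right_distrib
  have transposed: "(G21 *v p) v* H21 = p v* V - Y *v (R *v p)" "(Bc *v q) v* H21 = E *v q"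
    "(Ac *v (G21 *v p)) v* H21 =
       L *v p - Y *v (A *v (R *v p)) - E *v (C2 *v (R *v p)) - Y *v (B2 *v (F *v p))"
    for p q
    using GH'[of p] E'[of q] L'[of p] by simp_all
  show "state_blk A B2 C2 R Y L E F = W ** A_cl A B2 C2 Ac Bc Cc ** U"
    unfolding matrix_eq
  proof
    fix x :: "real^('n + 'n)"
    obtain p r where x: "x = vjoin p r" by (rule vjoin_exhaust)
    show "state_blk A B2 C2 R Y L E F *v x = W ** A_cl A B2 C2 Ac Bc Cc ** U *v x"
      by (simp add: x W_def U_def state_blk_def A_cl_def s vjoin_arith F' transposed
          vector_matrix_left_distrib algebra_simps)
  qed
  show "slack_blk R V Y = W ** U"
    unfolding matrix_eq
  proof
    fix x :: "real^('n + 'n)"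
    obtain p r where x: "x = vjoin p r" by (rule vjoin_exhaust)
    show "slack_blk R V Y *v x = W ** U *v x"
      by (simp add: x Y W_def U_def slack_blk_def s vjoin_arith transposed)
  qed
  show "vcat B1 (transpose Y ** B1 + E ** D21) = W ** B_cl B1 D21 Bc"
    unfolding matrix_eq
    by (simp add: W_def B_cl_def s vjoin_arith Y transposed)
  show "(C1 ** R + D12 ** F ||| C1) = C_cl C1 D12 Cc ** U"
    unfolding matrix_eq
  proof
    fix x :: "real^('n + 'n)"
    obtain p r where x: "x = vjoin p r" by (rule vjoin_exhaust)
    show "(C1 ** R + D12 ** F ||| C1) *v x = C_cl C1 D12 Cc ** U *v x"
      by (simp add: x U_def C_cl_def s vjoin_arith F')
  qed
  show "(F ||| 0) = (0 ||| Cc) ** U"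
    unfolding matrix_eq
  proof
    fix x :: "real^('n + 'n)"
    obtain p r where x: "x = vjoin p r" by (rule vjoin_exhaust)
    show "(F ||| 0) *v x = (0 ||| Cc) ** U *v x"
      by (simp add: x U_def s vjoin_arith F')
  qed
qed

lemma lower_blk_left_invertible:
  fixes Y H :: "real^'n^'n"
  assumes "invertible H"
  obtains W' where "W' ** vcat (mat 1 ||| 0) (Y ||| transpose H) = mat 1"
proof -
  have "x = 0" if "vcat (mat 1 ||| 0) (Y ||| transpose H) *v x = 0" for x
  proof -
    obtain p r where x: "x = vjoin p r" by (rule vjoin_exhaust)
    have "p = 0" "transpose H *v r = 0" using that by (auto simp: x)
    moreover have "invertible (transpose H)" using assms by (rule transpose_invertible)
    ultimately have "r = 0"
      using matrix_left_invertible_ker[of "transpose H"] invertible_left_inverse by blast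
    then show ?thesis using \<open>p = 0\<close> by (simp add: x)
  qed
  then show ?thesis using that matrix_left_invertible_ker by blast
qed

section \<open>From the matrix inequalities to the closed loop\<close>

lemma neg_definite_form_less:
  assumes "neg_definite N" and "x \<noteq> 0"
  shows "x \<bullet> (N *v x) < 0"
  using assms by (simp add: neg_definite_def)

text \<open>The bounded real, reachability and output inequalities hold in the dual form, with
  \<open>X\<close> the inverse of the matrix of the storage function.\<close>
lemma closed_loop_inequalities:
  fixes A R V Y L G21 H21 Ac :: "real^'n^'n" and F Cc :: "real^'n^'u" and E Bc :: "real^'y^'n"
    and B1 :: "real^'w^'n" and C1 :: "real^'n^'z"
  assumes lmi: "lmi_feasible A B1 B2 C1 C2 D11 D12 D21 wmax ulim \<alpha> \<gamma> \<epsilon>1 \<epsilon>2 \<epsilon>3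
           R V Y M11 M12 M13 M21 M22 M23 L E F"
    and H: "invertible H21"
    and GH: "transpose G21 ** H21 = V - transpose R ** Y"
    and F: "Cc ** G21 = F" and E: "transpose H21 ** Bc = E"
    and L: "transpose H21 ** Ac ** G21 =
      L - transpose Y ** A ** R - E ** C2 ** R - transpose Y ** B2 ** F"
  obtains X1 X2 where "symmetric_matrix X1" "symmetric_matrix X2"
    and "\<And>s w z. (s, w, z) \<noteq> 0 \<Longrightarrow>
      2 * (s \<bullet> (A_cl A B2 C2 Ac Bc Cc *v (X1 *v s)))
      + 2 * (z \<bullet> (C_cl C1 D12 Cc *v (X1 *v s))) + 2 * (s \<bullet> (B_cl B1 D21 Bc *v w))
      + 2 * (z \<bullet> (D11 *v w)) - \<gamma> * (w \<bullet> w) - \<gamma> * (z \<bullet> z) < 0"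
    and "\<And>s w. (s, w) \<noteq> 0 \<Longrightarrow>
      2 * (s \<bullet> (A_cl A B2 C2 Ac Bc Cc *v (X2 *v s))) + \<alpha> * (s \<bullet> (X2 *v s))
      + 2 * (s \<bullet> (B_cl B1 D21 Bc *v w)) - \<alpha> * (w \<bullet> w) < 0"
    and "\<And>s u. (s, u) \<noteq> 0 \<Longrightarrow>
      - (s \<bullet> (X2 *v s)) - 2 * (u \<bullet> ((0 ||| Cc) *v (X2 *v s))) - (ulim\<^sup>2 / wmax\<^sup>2) * (u \<bullet> u) < 0"
proof -
  define W where "W = vcat (mat 1 ||| 0) (Y ||| transpose H21)"
  define U where "U = vcat (R ||| mat 1) (G21 ||| 0)"
  define Acl where "Acl = A_cl A B2 C2 Ac Bc Cc"
  define Bcl where "Bcl = B_cl B1 D21 Bc"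
  define Ccl where "Ccl = C_cl C1 D12 Cc"
  define M1 where "M1 = symblk M11 M12 M13"
  define M2 where "M2 = symblk M21 M22 M23"
  have Y: "transpose Y = Y" and M1: "transpose M1 = M1" and M2: "transpose M2 = M2"
    and lmi1: "neg_definite (performance_matrix A B1 B2 C1 C2 D11 D12 D21 R V Y M11 M12 M13 L E F \<epsilon>1 \<gamma>)"
    and lmi2: "neg_definite (reachability_matrix A B1 B2 C2 D21 R V Y M21 M22 M23 L E F \<epsilon>2 \<alpha>)"
    and lmi3: "neg_definite (saturation_matrix R V Y M21 M22 M23 F \<epsilon>3 (ulim\<^sup>2 / wmax\<^sup>2))"
    using lmi by (auto simp: lmi_feasible_def symmetric_matrix_def M1_def M2_def)
  note fac = closed_loop_factorization[OF Y GH F E L, folded W_def U_def Acl_def]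
  have facB: "vcat B1 (transpose Y ** B1 + E ** D21) = W ** Bcl"
    unfolding Bcl_def by (rule fac(3))
  have facC: "(C1 ** R + D12 ** F ||| C1) = Ccl ** U"
    unfolding Ccl_def by (rule fac(4))
  obtain W' where W': "W' ** W = mat 1"
    using lower_blk_left_invertible[OF H] unfolding W_def by metis
  define X1 where "X1 = W' ** M1 ** transpose W'"
  define X2 where "X2 = W' ** M2 ** transpose W'"
  have WW: "W' *v (W *v y) = y" for y
    using W' by (simp add: matrix_vector_mul_assoc)
  have pW: "(s v* W') \<bullet> (W *v y) = s \<bullet> y" for s y
    using W' by (simp add: dot_lmul_matrix matrix_vector_mul_assoc)
  have s0: "s = 0" if "s v* W' = 0" for s
    using pW[of s s] that by simp
  have sym: "symmetric_matrix X1" "symmetric_matrix X2"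
    by (simp_all add: symmetric_matrix_def X1_def X2_def matrix_transpose_mul M1 M2 matrix_mul_assoc)
  have 1: "2 * (s \<bullet> (Acl *v (X1 *v s))) + 2 * (z \<bullet> (Ccl *v (X1 *v s)))
      + 2 * (s \<bullet> (Bcl *v w)) + 2 * (z \<bullet> (D11 *v w)) - \<gamma> * (w \<bullet> w) - \<gamma> * (z \<bullet> z) < 0"
    if nz: "(s, w, z) \<noteq> 0" for s w z
  proof -
    define p where "p = s v* W'"
    define q where "q = (- (s v* Acl) - (-1/2) *\<^sub>R s - z v* Ccl) v* W'"
    obtain p1 p2 where p: "p = vjoin p1 p2" by (rule vjoin_exhaust)
    obtain q1 q2 where q: "q = vjoin q1 q2" by (rule vjoin_exhaust)
    have N: "state_blk A B2 C2 R Y L E F - (1/2) *\<^sub>R slack_blk R V Y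
       = W ** Acl ** U + (-1/2) *\<^sub>R (W ** U)"
      unfolding fac by simp
    have "vjoin p1 (vjoin p2 (vjoin w (vjoin z (vjoin q1 q2)))) \<noteq> 0"
      using nz s0[of s] p by (auto simp: p_def zero_prod_def)
    note neg_definite_form_less[OF lmi1 this]
    then show ?thesis
      unfolding performance_form unfolding p[symmetric] q[symmetric] M1_def[symmetric]
      unfolding dilated_form_elimination[OF W' N fac(2) facC X1_def p_def q_def M1]
        facB
      by (simp add: p_def matrix_vector_mul_assoc[symmetric] WW dot_lmul_matrix)
  qed
  have 2: "2 * (s \<bullet> (Acl *v (X2 *v s))) + \<alpha> * (s \<bullet> (X2 *v s))
      + 2 * (s \<bullet> (Bcl *v w)) - \<alpha> * (w \<bullet> w) < 0"
    if nz: "(s, w) \<noteq> 0" for s w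
  proof -
    \<comment> \<open>The reachability inequality has no output block: the elimination is used with output zero.\<close>
    define K :: "real^('n+'n)^'n" where "K = 0"
    define p where "p = s v* W'"
    define q where "q = (- (s v* Acl) - (\<alpha>/2 - 1/2) *\<^sub>R s - 0 v* K) v* W'"
    obtain p1 p2 where p: "p = vjoin p1 p2" by (rule vjoin_exhaust)
    obtain q1 q2 where q: "q = vjoin q1 q2" by (rule vjoin_exhaust)
    have N: "state_blk A B2 C2 R Y L E F + (\<alpha>/2 - 1/2) *\<^sub>R slack_blk R V Y
       = W ** Acl ** U + (\<alpha>/2 - 1/2) *\<^sub>R (W ** U)"
      unfolding fac by simp
    have K: "(0 :: real^('n+'n)^'n) = K ** U"
      by (simp add: K_def matrix_eq matrix_vector_mul_assoc[symmetric])
    have "vjoin p1 (vjoin p2 (vjoin w (vjoin q1 q2))) \<noteq> 0"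
      using nz s0[of s] p by (auto simp: p_def zero_prod_def)
    note neg_definite_form_less[OF lmi2 this]
    then show ?thesis
      unfolding reachability_form unfolding p[symmetric] q[symmetric] M2_def[symmetric]
      unfolding dilated_form_elimination[OF W' N fac(2) K X2_def p_def q_def M2]
        facB
      by (simp add: p_def matrix_vector_mul_assoc[symmetric] WW dot_lmul_matrix)
  qed
  have 3: "- (s \<bullet> (X2 *v s)) - 2 * (u \<bullet> ((0 ||| Cc) *v (X2 *v s))) - (ulim\<^sup>2 / wmax\<^sup>2) * (u \<bullet> u) < 0"
    if nz: "(s, u) \<noteq> 0" for s u
  proof -
    \<comment> \<open>Here \<open>N = -G\<close>, which is the case of zero dynamics with \<open>\<kappa> = -1\<close>.\<close>
    define Z :: "real^('n+'n)^('n+'n)" where "Z = 0"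
    define K :: "real^('n+'n)^'u" where "K = - (0 ||| Cc)"
    define p where "p = s v* W'"
    define q where "q = (- (s v* Z) - (-1) *\<^sub>R s - u v* K) v* W'"
    obtain p1 p2 where p: "p = vjoin p1 p2" by (rule vjoin_exhaust)
    obtain q1 q2 where q: "q = vjoin q1 q2" by (rule vjoin_exhaust)
    have N: "- slack_blk R V Y = W ** Z ** U + (-1) *\<^sub>R (W ** U)"
      unfolding fac by (simp add: Z_def matrix_eq matrix_vector_mul_assoc[symmetric] 
          matrix_vector_mult_diff_rdistrib matrix_vector_mult_add_rdistrib uminus_matrix_vector_mult)
    have "(- F ||| 0) = - (F ||| (0 :: real^'n^'u))"
      by (simp add: hcat_def vec_eq_iff split: sum.splits)
    moreover have "- ((0 ||| Cc) ** U) = K ** U"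
      by (simp add: K_def matrix_eq matrix_vector_mul_assoc[symmetric] uminus_matrix_vector_mult)
    ultimately have K: "(- F ||| 0) = K ** U"
      by (simp only: fac(5))
    have "vjoin p1 (vjoin p2 (vjoin u (vjoin q1 q2))) \<noteq> 0"
      using nz s0[of s] p by (auto simp: p_def zero_prod_def)
    note neg_definite_form_less[OF lmi3 this]
    then show ?thesis
      unfolding saturation_form unfolding p[symmetric] q[symmetric] M2_def[symmetric]
      unfolding dilated_form_elimination[OF W' N fac(2) K X2_def p_def q_def M2]
      by (simp add: Z_def K_def uminus_matrix_vector_mult dot_lmul_matrix)
  qed
  show ?thesis
    by (rule that[OF sym 1[unfolded Acl_def Bcl_def Ccl_def] 2[unfolded Acl_def Bcl_def] 3])
qed

text \<open>Substituting \<open>s = X\<^sup>-\<^sup>1x\<close> and the maximizer \<open>z = (Cx + Dw)/\<gamma>\<close> gives the dissipation inequality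
  with the storage function \<open>x\<cdot>X\<^sup>-\<^sup>1x\<close>. The margin \<open>d\<close> of the strict inequality improves the gain to
  \<open>g = sqrt (\<gamma> (\<gamma> - d)) < \<gamma>\<close>.\<close>
lemma bounded_real_attenuation:
  fixes A X :: "real^'n^'n" and B :: "real^'w^'n" and C :: "real^'n^'z"
  assumes A: "hurwitz A" and X: "pos_definite X"
    and neg: "\<And>s w z. (s, w, z) \<noteq> 0 \<Longrightarrow>
      2 * (s \<bullet> (A *v (X *v s))) + 2 * (z \<bullet> (C *v (X *v s))) + 2 * (s \<bullet> (B *v w))
      + 2 * (z \<bullet> (D *v w)) - \<gamma> * (w \<bullet> w) - \<gamma> * (z \<bullet> z) < 0"
  shows "attenuation_level A B C D \<gamma>"
proof -
  obtain P where P: "pos_definite P" and XP: "X ** P = mat 1"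
    using pos_definite_inverse[OF X] by metis
  have XP': "X *v (P *v x) = x" for x using XP by (simp add: matrix_vector_mul_assoc)
  have Psym: "symmetric_matrix P" using P by (simp add: pos_definite_def)
  have psd: "0 \<le> x \<bullet> (P *v x)" for x
    using P by (cases "x = 0") (auto simp: pos_definite_def less_imp_le)
  define f where "f = (\<lambda>(s, w, z). 
      2 * (s \<bullet> (A *v (X *v s))) + 2 * (z \<bullet> (C *v (X *v s))) + 2 * (s \<bullet> (B *v w))
      + 2 * (z \<bullet> (D *v w)) - \<gamma> * (w \<bullet> w) - \<gamma> * (z \<bullet> z))"
  have mc: "continuous_on S (\<lambda>x. M *v h x)" if "continuous_on S h" 
    for M :: "real^'k^'l" and h and S :: "((real^'n) \<times> (real^'w) \<times> (real^'z)) set"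
    by (rule continuous_on_compose2[OF matrix_vector_mult_linear_continuous_on[of UNIV] that]) auto
  have "continuous_on UNIV f"
    unfolding f_def case_prod_beta by (intro continuous_intros mc)
  moreover have "f (c *\<^sub>R x) = c\<^sup>2 * f x" for c x
    by (cases x) (simp add: f_def matrix_vector_mult_scaleR power2_eq_square algebra_simps)
  moreover have "f x < 0" if "x \<noteq> 0" for x
    using neg that by (cases x) (auto simp: f_def)
  ultimately obtain d where d: "0 < d" and fd: "\<And>x. f x \<le> - d * (norm x)\<^sup>2"
    using negative_quadratic_bound[of f] by blast
  obtain w0 :: "real^'w" where w0: "norm w0 = 1" using vector_choose_size[of 1] by auto
  have "d \<le> \<gamma>"
    using fd[of "(0, w0, 0)"] w0 by (simp add: f_def norm_Pair power2_norm_eq_inner[symmetric])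
  then have \<gamma>: "0 < \<gamma>" using d by simp
  define g where "g = sqrt (\<gamma> * (\<gamma> - d))"
  have g0: "0 \<le> g" using \<open>d \<le> \<gamma>\<close> \<gamma> by (simp add: g_def)
  have g2: "g\<^sup>2 = \<gamma> * (\<gamma> - d)" using \<open>d \<le> \<gamma>\<close> \<gamma> by (simp add: g_def)
  have "0 < \<gamma> * d" using d \<gamma> by (rule mult_pos_pos[rotated])
  then have "g\<^sup>2 < \<gamma>\<^sup>2" unfolding g2 unfolding power2_eq_square right_diff_distrib by linarith
  then have g: "g < \<gamma>" by (rule power2_less_imp_less) (rule less_imp_le[OF \<gamma>])
  have diss: "2 * ((P *v x) \<bullet> (A *v x + B *v w)) \<le> (1/\<gamma>) * (g\<^sup>2 * (norm w)\<^sup>2 - (norm (C *v x + D *v w))\<^sup>2)"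
    for x w
  proof -
    define y where "y = C *v x + D *v w"
    define z where "z = (1/\<gamma>) *\<^sub>R y"
    have "f (P *v x, w, z) = 2 * ((P *v x) \<bullet> (A *v x + B *v w)) 
        + 2 * (z \<bullet> y) - \<gamma> * (w \<bullet> w) - \<gamma> * (z \<bullet> z)"
      by (simp add: f_def y_def XP' inner_add_right)
    also have "\<dots> = 2 * ((P *v x) \<bullet> (A *v x + B *v w)) + (1/\<gamma>) * (norm y)\<^sup>2 - \<gamma> * (norm w)\<^sup>2"
      using \<gamma> by (simp add: z_def power2_norm_eq_inner)
    finally have "2 * ((P *v x) \<bullet> (A *v x + B *v w)) + (1/\<gamma>) * (norm y)\<^sup>2 - \<gamma> * (norm w)\<^sup>2
       \<le> - d * (norm (P *v x, w, z))\<^sup>2"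
      using fd[of "(P *v x, w, z)"] by simp
    also have "\<dots> \<le> - d * (norm w)\<^sup>2"
      using d by (simp add: norm_Pair)
    finally have "2 * ((P *v x) \<bullet> (A *v x + B *v w)) \<le> (\<gamma> - d) * (norm w)\<^sup>2 - (1/\<gamma>) * (norm y)\<^sup>2"
      by (simp add: algebra_simps)
    also have "\<dots> = (1/\<gamma>) * (g\<^sup>2 * (norm w)\<^sup>2 - (norm y)\<^sup>2)"
      using \<gamma> by (simp add: g2 field_simps)
    finally show ?thesis by (simp only: y_def)
  qed
  have "hinf_norm A B C D \<le> ereal g"
    by (rule hinf_norm_le[OF A Psym g0 diss]) (use \<gamma> in simp)
  moreover have "l2_gain A B C D \<le> ereal g"
    unfolding l2_gain_def
  proof (rule Inf_lower, rule CollectI, intro exI conjI allI impI)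
    show "ereal g = ereal g" ..
    fix w x
    assume "w \<in> borel_measurable (lebesgue_on {0..}) \<and> energy w < \<infinity> \<and> zero_state_trajectory A B w x"
    then show "energy (\<lambda>t. C *v x t + D *v w t) \<le> ennreal (g\<^sup>2) * energy w"
      using energy_gain_bound[OF Psym psd _ _ _ diss] \<gamma> by simp
  qed (rule g0)
  moreover have "ereal g < ereal \<gamma>" using g by simp
  ultimately show ?thesis
    unfolding attenuation_level_def by (blast intro: order_le_less_trans)
qed

text \<open>Setting the disturbance or the output variable to zero in the inequalities gives the
  definiteness of \<open>X\<^sub>2\<close> and the Lyapunov inequalities; \<open>P\<close> is the inverse of \<open>X\<^sub>2\<close>.\<close>
lemma good_compensator_from_inequalities:
  fixes A Ac :: "real^'n^'n" and X1 X2 :: "real^('n+'n)^('n+'n)"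
    and B1 :: "real^'w^'n" and C1 :: "real^'n^'z" and Cc :: "real^'n^'u"
  assumes pos: "0 < wmax" "0 < ulim" "0 < \<alpha>"
    and sym: "symmetric_matrix X1" "symmetric_matrix X2"
    and perf: "\<And>s w z. (s, w, z) \<noteq> 0 \<Longrightarrow>
      2 * (s \<bullet> (A_cl A B2 C2 Ac Bc Cc *v (X1 *v s)))
      + 2 * (z \<bullet> (C_cl C1 D12 Cc *v (X1 *v s))) + 2 * (s \<bullet> (B_cl B1 D21 Bc *v w))
      + 2 * (z \<bullet> (D11 *v w)) - \<gamma> * (w \<bullet> w) - \<gamma> * (z \<bullet> z) < 0"
    and reach: "\<And>s w. (s, w) \<noteq> 0 \<Longrightarrow>
      2 * (s \<bullet> (A_cl A B2 C2 Ac Bc Cc *v (X2 *v s))) + \<alpha> * (s \<bullet> (X2 *v s))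
      + 2 * (s \<bullet> (B_cl B1 D21 Bc *v w)) - \<alpha> * (w \<bullet> w) < 0"
    and sat: "\<And>s u. (s, u) \<noteq> 0 \<Longrightarrow>
      - (s \<bullet> (X2 *v s)) - 2 * (u \<bullet> ((0 ||| Cc) *v (X2 *v s))) - (ulim\<^sup>2 / wmax\<^sup>2) * (u \<bullet> u) < 0"
  shows "good_compensator A B1 B2 C1 C2 D11 D12 D21 wmax ulim \<gamma> Ac Bc Cc"
proof -
  define Acl where "Acl = A_cl A B2 C2 Ac Bc Cc"
  define Bcl where "Bcl = B_cl B1 D21 Bc"
  define \<rho> where "\<rho> = ulim\<^sup>2 / wmax\<^sup>2"
  have \<rho>: "0 < \<rho>" using pos by (simp add: \<rho>_def)
  have X2: "pos_definite X2"
    unfolding pos_definite_def using sat[of _ 0] sym by (auto simp: zero_prod_def)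
  have AX2: "s \<bullet> (Acl *v (X2 *v s)) < 0" if "s \<noteq> 0" for s
  proof -
    have "2 * (s \<bullet> (Acl *v (X2 *v s))) + \<alpha> * (s \<bullet> (X2 *v s)) < 0"
      using reach[of s 0] that by (auto simp: zero_prod_def Acl_def)
    moreover have "0 < \<alpha> * (s \<bullet> (X2 *v s))"
      using X2 that pos by (simp add: pos_definite_def)
    ultimately show ?thesis by linarith
  qed
  have AX1: "s \<bullet> (Acl *v (X1 *v s)) < 0" if "s \<noteq> 0" for s
    using perf[of s 0 0] that by (auto simp: zero_prod_def Acl_def)
  have X1: "pos_definite X1"
    by (rule lyapunov_solution_pos_definite[OF X2 AX2 sym(1) AX1])
  obtain P where P: "pos_definite P" and XP: "X2 ** P = mat 1"
    using pos_definite_inverse[OF X2] by metis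
  have XP': "X2 *v (P *v x) = x" for x using XP by (simp add: matrix_vector_mul_assoc)
  have Psym: "symmetric_matrix P" using P by (simp add: pos_definite_def)
  have hur: "hurwitz Acl"
  proof (rule lyapunov_hurwitz[OF P])
    fix x :: "real^('n+'n)" assume "x \<noteq> 0"
    then have "P *v x \<noteq> 0" using XP'[of x] by auto
    from AX2[OF this] show "(P *v x) \<bullet> (Acl *v x) < 0" by (simp add: XP')
  qed
  have diss: "2 * ((P *v x) \<bullet> (Acl *v x + Bcl *v w)) \<le> \<alpha> * (w \<bullet> w) - \<alpha> * (x \<bullet> (P *v x))" for x w
    using reach[of "P *v x" w]
    by (cases "(P *v x, w) = 0") (auto simp: zero_prod_def XP' Acl_def Bcl_def inner_add_right inner_commute)
  have out: "(norm (Cc *v compensator_state x))\<^sup>2 \<le> \<rho> * (x \<bullet> (P *v x))" for x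
  proof -
    obtain p r where x: "x = vjoin p r" by (rule vjoin_exhaust)
    have "compensator_state x = r" by (simp add: x compensator_state_def vjoin_def vec_eq_iff)
    then have K: "(0 ||| Cc) *v x = Cc *v compensator_state x" by (simp add: x)
    define y where "y = Cc *v compensator_state x"
    \<comment> \<open>This \<open>u\<close> maximizes \<open>- 2 u\<cdot>y - \<rho> u\<cdot>u\<close>, and the maximum is \<open>\<parallel>y\<parallel>\<^sup>2/\<rho>\<close>.\<close>
    define u where "u = - (1/\<rho>) *\<^sub>R y"
    have "- ((P *v x) \<bullet> x) - 2 * (u \<bullet> y) - \<rho> * (u \<bullet> u) \<le> 0"
      using sat[of "P *v x" u] by (cases "(P *v x, u) = 0") (auto simp: zero_prod_def XP' K y_def \<rho>_def)
    moreover have "2 * (u \<bullet> y) + \<rho> * (u \<bullet> u) = - (norm y)\<^sup>2 / \<rho>"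
      using \<rho> by (simp add: u_def power2_norm_eq_inner field_simps)
    ultimately have "(norm y)\<^sup>2 / \<rho> \<le> x \<bullet> (P *v x)"
      by (simp add: inner_commute)
    then show ?thesis using \<rho> by (simp add: y_def field_simps)
  qed
  have sat: "never_saturates A B1 B2 C2 D21 wmax ulim Ac Bc Cc"
    unfolding never_saturates_def
  proof (intro allI impI, elim conjE)
    fix w :: "real \<Rightarrow> real^'w" and x t
    assume w: "w \<in> borel_measurable (lebesgue_on {0..})" "\<forall>t\<ge>0. w t \<bullet> w t \<le> wmax\<^sup>2"
      and tr: "zero_state_trajectory (A_cl A B2 C2 Ac Bc Cc) (B_cl B1 D21 Bc) w x" and t: "0 \<le> (t::real)"
    have "x t \<bullet> (P *v x t) \<le> wmax\<^sup>2"
      by (rule reachable_ellipsoid[OF Psym tr[folded Acl_def Bcl_def] w(1) _ pos(3) diss t]) (use w(2) in auto)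
    then have "\<rho> * (x t \<bullet> (P *v x t)) \<le> \<rho> * wmax\<^sup>2"
      using \<rho> by (intro mult_left_mono) auto
    also have "\<dots> = ulim\<^sup>2" using pos by (simp add: \<rho>_def)
    finally have "(norm (Cc *v compensator_state (x t)))\<^sup>2 \<le> ulim\<^sup>2"
      using out[of "x t"] by linarith
    then show "norm (Cc *v compensator_state (x t)) \<le> ulim"
      by (rule power2_le_imp_le) (use pos in simp)
  qed
  have "attenuation_level Acl Bcl (C_cl C1 D12 Cc) D11 \<gamma>"
    by (rule bounded_real_attenuation[OF hur X1]) (use perf in \<open>simp add: Acl_def Bcl_def\<close>)
  then show ?thesis
    using hur sat by (simp add: good_compensator_def Acl_def Bcl_def)
qed

section \<open>Perturbing the variables\<close>

text \<open>\<open>det (M + tI)\<close> is a polynomial in \<open>t\<close>. It is not zero, since \<open>M + tI\<close> is injective once \<open>t\<close>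
  exceeds the operator norm of \<open>M\<close>, and so it has finitely many roots.\<close>
lemma invertible_small_shift:
  fixes M :: "real^'n^'n"
  assumes "0 < e"
  obtains t where "0 < t" "t < e" "invertible (M + t *\<^sub>R mat 1)"
proof -
  define p where "p = det (\<chi> i j. [:M $ i $ j, (mat 1 :: real^'n^'n) $ i $ j:])"
  have p: "poly p t = det (M + t *\<^sub>R mat 1)" for t
    unfolding p_def det_def
    by (simp add: poly_sum poly_prod)
  obtain k where k: "0 < k" "\<And>v. norm (M *v v) \<le> norm v * k"
    using bounded_linear.pos_bounded[OF matrix_vector_mul_bounded_linear[of M]] by blast
  have "x = 0" if "(M + (k + 1) *\<^sub>R mat 1) *v x = 0" for x
  proof -
    have "M *v x = - ((k + 1) *\<^sub>R x)"
      using that by (simp add: matrix_vector_mult_add_rdistrib scaleR_matrix_vector_mult eq_neg_iff_add_eq_0)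
    then have "(k + 1) * norm x \<le> norm x * k" using k(2)[of x] k(1) by simp
    then show ?thesis by (simp add: algebra_simps)
  qed
  then have "poly p (k + 1) \<noteq> 0"
    unfolding p invertible_det_nz[symmetric] invertible_left_inverse matrix_left_invertible_ker by blast
  then have "p \<noteq> 0" by auto
  then have "finite {t. poly p t = 0}" by (rule poly_roots_finite)
  moreover have "infinite {0<..<e}" using assms by (simp add: infinite_Ioo)
  ultimately obtain t where "t \<in> {0<..<e}" "poly p t \<noteq> 0"
    by (metis (mono_tags, lifting) finite_subset mem_Collect_eq subsetI)
  then show ?thesis using that[of t] p[of t] by (simp add: invertible_det_nz)
qed

lemma neg_definite_perturb:
  fixes N J :: "real^'m^'m"
  assumes N: "neg_definite N" and J: "symmetric_matrix J"
  shows "\<exists>e>0. \<forall>t. \<bar>t\<bar> < e \<longrightarrow> neg_definite (N + t *\<^sub>R J)"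
proof -
  have "continuous_on UNIV (\<lambda>x. x \<bullet> (N *v x))"
    by (intro continuous_intros matrix_vector_mult_linear_continuous_on)
  then have "\<exists>d>0. \<forall>x. x \<bullet> (N *v x) \<le> - d * (norm x)\<^sup>2"
    by (rule negative_quadratic_bound)
      (use N in \<open>auto simp: neg_definite_def matrix_vector_mult_scaleR power2_eq_square\<close>)
  then obtain d where d: "0 < d" and Nd: "\<And>x. x \<bullet> (N *v x) \<le> - d * (norm x)\<^sup>2"
    by blast
  obtain k where k: "0 < k" "\<And>v. norm (J *v v) \<le> norm v * k"
    using bounded_linear.pos_bounded[OF matrix_vector_mul_bounded_linear[of J]] by blast
  have "neg_definite (N + t *\<^sub>R J)" if t: "\<bar>t\<bar> < d / k" for t
    unfolding neg_definite_def
  proof (intro conjI allI impI)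
    show "symmetric_matrix (N + t *\<^sub>R J)"
      using N J by (simp add: neg_definite_def symmetric_matrix_def transpose_def vec_eq_iff)
    fix x :: "real^'m" assume x: "x \<noteq> 0"
    have "\<bar>t * (x \<bullet> (J *v x))\<bar> \<le> \<bar>t\<bar> * (norm x * (norm x * k))"
      unfolding abs_mult
      by (intro mult_left_mono order_trans[OF Cauchy_Schwarz_ineq2] k) auto
    also have "\<dots> = (\<bar>t\<bar> * k) * (norm x)\<^sup>2" by (simp add: power2_eq_square)
    also have "\<dots> < d * (norm x)\<^sup>2"
      using t k x by (intro mult_strict_right_mono) (auto simp: field_simps)
    finally show "x \<bullet> ((N + t *\<^sub>R J) *v x) < 0"
      using Nd[of x] by (simp add: matrix_vector_mult_add_rdistrib scaleR_matrix_vector_mult inner_add_right)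
  qed
  then show ?thesis using d k by (intro exI[of _ "d / k"]) simp
qed

lemma symblk_affine:
  "symblk P Q S + t *\<^sub>R symblk P' Q' S' = symblk (P + t *\<^sub>R P') (Q + t *\<^sub>R Q') (S + t *\<^sub>R S')"
  by (auto simp: symblk_def vcat_def hcat_def transpose_def vec_eq_iff split: sum.splits)

lemma hcat_affine:
  "(P ||| Q) + t *\<^sub>R (P' ||| Q') = (P + t *\<^sub>R P' ||| Q + t *\<^sub>R Q')"
  by (auto simp: hcat_def vec_eq_iff split: sum.splits)

lemma symmetric_symblk:
  "symmetric_matrix P \<Longrightarrow> symmetric_matrix S \<Longrightarrow> symmetric_matrix (symblk P Q S)"
  by (auto simp: symmetric_matrix_def symblk_def vcat_def hcat_def transpose_def vec_eq_iff split: sum.splits)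

lemma symmetric_zero: "symmetric_matrix 0"
  by (simp add: symmetric_matrix_def transpose_def vec_eq_iff)

lemma transpose_shift: "transpose (V + t *\<^sub>R mat 1) = transpose (V::real^'n^'n) + t *\<^sub>R mat 1"
  by (auto simp: transpose_def vec_eq_iff mat_def)

text \<open>The three matrices are affine in \<open>V\<close>, which occurs only off the diagonal. So shifting \<open>V\<close> adds
  a multiple of a fixed symmetric matrix.\<close>
lemma performance_matrix_shift:
  "performance_matrix A B1 B2 C1 C2 D11 D12 D21 R (V + t *\<^sub>R mat 1) Y Ma Mb Mc L E F \<epsilon> \<gamma> =
   performance_matrix A B1 B2 C1 C2 D11 D12 D21 R V Y Ma Mb Mc L E F \<epsilon> \<gamma> + t *\<^sub>R
     symblk 0 ((-1/2) *\<^sub>R mat 1 ||| 0 ||| 0 ||| 0 ||| mat 1)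
     (symblk 0 (0 ||| 0 ||| \<epsilon> *\<^sub>R mat 1 ||| 0)
     (symblk 0 (0 ||| 0 ||| 0)
     (symblk 0 (0 ||| 0)
     (symblk 0 ((- 2 * \<epsilon>) *\<^sub>R mat 1) 0))))"
  unfolding performance_matrix_def Let_def symblk_affine hcat_affine
  by (simp add: transpose_shift Omega_blk_def Gamma_blk_def Upsilon_blk_def algebra_simps)

lemma reachability_matrix_shift:
  "reachability_matrix A B1 B2 C2 D21 R (V + t *\<^sub>R mat 1) Y Ma Mb Mc L E F \<epsilon> \<alpha> =
   reachability_matrix A B1 B2 C2 D21 R V Y Ma Mb Mc L E F \<epsilon> \<alpha> + t *\<^sub>R
     symblk 0 ((\<alpha>/2 - 1/2) *\<^sub>R mat 1 ||| 0 ||| 0 ||| mat 1)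
     (symblk 0 (0 ||| (\<epsilon> - \<epsilon> * \<alpha>) *\<^sub>R mat 1 ||| 0)
     (symblk 0 (0 ||| 0)
     (symblk 0 ((- 2 * \<epsilon>) *\<^sub>R mat 1) 0)))"
  unfolding reachability_matrix_def Let_def symblk_affine hcat_affine
  by (simp add: transpose_shift Omega_blk_def Gamma_blk_def Upsilon_blk_def algebra_simps)

lemma saturation_matrix_shift:
  "saturation_matrix R (V + t *\<^sub>R mat 1) Y Ma Mb Mc F \<epsilon> \<rho> =
   saturation_matrix R V Y Ma Mb Mc F \<epsilon> \<rho> + t *\<^sub>R
     symblk 0 (- mat 1 ||| 0 ||| 0 ||| mat 1)
     (symblk 0 (0 ||| (2 * \<epsilon>) *\<^sub>R mat 1 ||| 0)
     (symblk 0 (0 ||| 0)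
     (symblk 0 ((- 2 * \<epsilon>) *\<^sub>R mat 1) 0)))"
  unfolding saturation_matrix_def symblk_affine hcat_affine
  by (simp add: transpose_shift algebra_simps)

lemma lmi_feasible_small_shift:
  assumes "lmi_feasible A B1 B2 C1 C2 D11 D12 D21 wmax ulim \<alpha> \<gamma> \<epsilon>1 \<epsilon>2 \<epsilon>3
           R V Y M11 M12 M13 M21 M22 M23 L E F"
  obtains e where "0 < e" "\<And>t. \<bar>t\<bar> < e \<Longrightarrow>
    lmi_feasible A B1 B2 C1 C2 D11 D12 D21 wmax ulim \<alpha> \<gamma> \<epsilon>1 \<epsilon>2 \<epsilon>3
           R (V + t *\<^sub>R mat 1) Y M11 M12 M13 M21 M22 M23 L E F"
proof -
  have Y: "symmetric_matrix Y" and M: "symmetric_matrix (symblk M11 M12 M13)" "symmetric_matrix (symblk M21 M22 M23)"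
    and nd: "neg_definite (performance_matrix A B1 B2 C1 C2 D11 D12 D21 R V Y M11 M12 M13 L E F \<epsilon>1 \<gamma>)"
    "neg_definite (reachability_matrix A B1 B2 C2 D21 R V Y M21 M22 M23 L E F \<epsilon>2 \<alpha>)"
    "neg_definite (saturation_matrix R V Y M21 M22 M23 F \<epsilon>3 (ulim\<^sup>2 / wmax\<^sup>2))"
    using assms by (auto simp: lmi_feasible_def)
  obtain e1 where e1: "0 < e1" "\<And>t. \<bar>t\<bar> < e1 \<Longrightarrow> neg_definite
      (performance_matrix A B1 B2 C1 C2 D11 D12 D21 R (V + t *\<^sub>R mat 1) Y M11 M12 M13 L E F \<epsilon>1 \<gamma>)"
    using neg_definite_perturb[OF nd(1)] unfolding performance_matrix_shift
    by (metis symmetric_symblk symmetric_zero)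
  obtain e2 where e2: "0 < e2" "\<And>t. \<bar>t\<bar> < e2 \<Longrightarrow> neg_definite
      (reachability_matrix A B1 B2 C2 D21 R (V + t *\<^sub>R mat 1) Y M21 M22 M23 L E F \<epsilon>2 \<alpha>)"
    using neg_definite_perturb[OF nd(2)] unfolding reachability_matrix_shift
    by (metis symmetric_symblk symmetric_zero)
  obtain e3 where e3: "0 < e3" "\<And>t. \<bar>t\<bar> < e3 \<Longrightarrow> neg_definite
      (saturation_matrix R (V + t *\<^sub>R mat 1) Y M21 M22 M23 F \<epsilon>3 (ulim\<^sup>2 / wmax\<^sup>2))"
    using neg_definite_perturb[OF nd(3)] unfolding saturation_matrix_shift
    by (metis symmetric_symblk symmetric_zero)
  show ?thesis
    by (rule that[of "min e1 (min e2 e3)"]) (use Y M e1 e2 e3 in \<open>auto simp: lmi_feasible_def\<close>)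
qed

lemma lmi_feasible_nearby_invertible:
  assumes lmi: "lmi_feasible A B1 B2 C1 C2 D11 D12 D21 wmax ulim \<alpha> \<gamma> \<epsilon>1 \<epsilon>2 \<epsilon>3
           R V Y M11 M12 M13 M21 M22 M23 L E F" and \<delta>: "0 < \<delta>"
  obtains V' where "norm (V' - V) < \<delta>" "invertible (V' - transpose R ** Y)"
    "lmi_feasible A B1 B2 C1 C2 D11 D12 D21 wmax ulim \<alpha> \<gamma> \<epsilon>1 \<epsilon>2 \<epsilon>3
           R V' Y M11 M12 M13 M21 M22 M23 L E F"
proof -
  obtain e where e: "0 < e" and lmi': "\<And>t. \<bar>t\<bar> < e \<Longrightarrow>
    lmi_feasible A B1 B2 C1 C2 D11 D12 D21 wmax ulim \<alpha> \<gamma> \<epsilon>1 \<epsilon>2 \<epsilon>3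
           R (V + t *\<^sub>R mat 1) Y M11 M12 M13 M21 M22 M23 L E F"
    using lmi_feasible_small_shift[OF lmi] by blast
  define k where "k = norm (mat 1 :: real^'a^'a) + 1"
  have k: "0 < k" by (simp add: k_def add_nonneg_pos)
  obtain t where t: "0 < t" "t < min e (\<delta> / k)" "invertible ((V - transpose R ** Y) + t *\<^sub>R mat 1)"
    using invertible_small_shift[of "min e (\<delta> / k)"] e \<delta> k by auto
  have "t * norm (mat 1 :: real^'a^'a) \<le> t * k" using t by (simp add: k_def)
  also have "\<dots> < \<delta>" using t k by (simp add: field_simps)
  finally have n: "norm ((V + t *\<^sub>R mat 1) - V) < \<delta>" using t by simp
  have i: "invertible ((V + t *\<^sub>R mat 1) - transpose R ** Y)"
    using t(3) by (simp add: algebra_simps)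
  show ?thesis by (rule that[OF n i lmi']) (use t in simp)
qed

section \<open>The compensator\<close>

lemma lmi_compensator_good:
  fixes A R V Y L G21 H21 :: "real^'n^'n" and F :: "real^'n^'u" and E :: "real^'y^'n"
    and B1 :: "real^'w^'n" and C1 :: "real^'n^'z"
  assumes pos: "0 < wmax" "0 < ulim" "0 < \<alpha>"
    and lmi: "lmi_feasible A B1 B2 C1 C2 D11 D12 D21 wmax ulim \<alpha> \<gamma> \<epsilon>1 \<epsilon>2 \<epsilon>3
           R V Y M11 M12 M13 M21 M22 M23 L E F"
    and G: "invertible G21" and H: "invertible H21"
    and GH: "transpose G21 ** H21 = V - transpose R ** Y"
  shows "good_compensator A B1 B2 C1 C2 D11 D12 D21 wmax ulim \<gamma>
         (transpose (matrix_inv H21) **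
            (L - transpose Y ** A ** R - E ** C2 ** R - transpose Y ** B2 ** F) **
            matrix_inv G21)
         (transpose (matrix_inv H21) ** E)
         (F ** matrix_inv G21)"
proof -
  have HH: "transpose H21 ** (transpose (matrix_inv H21) ** M) = M" for M :: "real^'k^'n"
    using matrix_inv_mult(2)[OF H]
    by (metis matrix_mul_assoc matrix_mul_lid matrix_transpose_mul transpose_mat)
  have GG: "M ** matrix_inv G21 ** G21 = M" for M :: "real^'n^'k"
    using matrix_inv_mult(2)[OF G] by (simp add: matrix_mul_assoc[symmetric])
  have HG: "transpose H21 ** (transpose (matrix_inv H21) ** M ** matrix_inv G21) ** G21 = M"
    for M :: "real^'n^'n"
  proof -
    have "transpose H21 ** (transpose (matrix_inv H21) ** M ** matrix_inv G21) =
        transpose H21 ** (transpose (matrix_inv H21) ** M) ** matrix_inv G21"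
      by (simp only: matrix_mul_assoc)
    then show ?thesis by (simp only: HH GG)
  qed
  show ?thesis
    by (rule closed_loop_inequalities[OF lmi H GH GG HH HG])
      (rule good_compensator_from_inequalities[OF pos])
qed

theorem lemma6:
  fixes A :: "real^'n^'n" and B1 :: "real^'w^'n" and B2 :: "real^'u^'n"
    and C1 :: "real^'n^'z" and C2 :: "real^'n^'y"
    and D11 :: "real^'w^'z" and D12 :: "real^'u^'z" and D21 :: "real^'w^'y"
    and wmax ulim \<alpha> \<gamma> \<epsilon>1 \<epsilon>2 \<epsilon>3 :: real
    and R V Y M11 M12 M13 M21 M22 M23 L :: "real^'n^'n"
    and E :: "real^'y^'n" and F :: "real^'n^'u"
  assumes "0 < wmax" and "0 < ulim" and "0 < \<alpha>"
    and "0 < \<epsilon>1" "\<epsilon>1 < 1" and "0 < \<epsilon>2" "\<epsilon>2 < 1" and "0 < \<epsilon>3" "\<epsilon>3 < 1"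
    and "lmi_feasible A B1 B2 C1 C2 D11 D12 D21 wmax ulim \<alpha> \<gamma> \<epsilon>1 \<epsilon>2 \<epsilon>3
           R V Y M11 M12 M13 M21 M22 M23 L E F"
  shows "(\<exists>Ac Bc Cc. good_compensator A B1 B2 C1 C2 D11 D12 D21 wmax ulim \<gamma> Ac Bc Cc) \<and>
    (\<forall>\<delta>>0. \<exists>R' V' Y' M11' M12' M13' M21' M22' M23' L' E' F'.
       norm (R' - R) < \<delta> \<and> norm (V' - V) < \<delta> \<and> norm (Y' - Y) < \<delta> \<and>
       norm (M11' - M11) < \<delta> \<and> norm (M12' - M12) < \<delta> \<and> norm (M13' - M13) < \<delta> \<and>
       norm (M21' - M21) < \<delta> \<and> norm (M22' - M22) < \<delta> \<and> norm (M23' - M23) < \<delta> \<and>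
       norm (L' - L) < \<delta> \<and> norm (E' - E) < \<delta> \<and> norm (F' - F) < \<delta> \<and>
       lmi_feasible A B1 B2 C1 C2 D11 D12 D21 wmax ulim \<alpha> \<gamma> \<epsilon>1 \<epsilon>2 \<epsilon>3
         R' V' Y' M11' M12' M13' M21' M22' M23' L' E' F' \<and>
       invertible (V' - transpose R' ** Y')) \<and>
    (\<forall>G21 H21. invertible G21 \<and> invertible H21 \<and>
       transpose G21 ** H21 = V - transpose R ** Y \<longrightarrow>
       good_compensator A B1 B2 C1 C2 D11 D12 D21 wmax ulim \<gamma>
         (transpose (matrix_inv H21) **
            (L - transpose Y ** A ** R - E ** C2 ** R - transpose Y ** B2 ** F) **
            matrix_inv G21)
         (transpose (matrix_inv H21) ** E)
         (F ** matrix_inv G21))"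
proof (intro conjI allI impI)
  note pos = assms(1-3)
  note lmi = assms(10)
  obtain V' where V': "invertible (V' - transpose R ** Y)"
    "lmi_feasible A B1 B2 C1 C2 D11 D12 D21 wmax ulim \<alpha> \<gamma> \<epsilon>1 \<epsilon>2 \<epsilon>3
           R V' Y M11 M12 M13 M21 M22 M23 L E F"
    by (rule lmi_feasible_nearby_invertible[OF lmi zero_less_one])
  have "invertible (mat 1 :: real^'n^'n)"
    unfolding invertible_def by (intro exI[of _ "mat 1"]) simp
  moreover have "transpose (mat 1) ** (V' - transpose R ** Y) = V' - transpose R ** Y"
    by simp
  ultimately have "good_compensator A B1 B2 C1 C2 D11 D12 D21 wmax ulim \<gamma>
         (transpose (matrix_inv (V' - transpose R ** Y)) **
            (L - transpose Y ** A ** R - E ** C2 ** R - transpose Y ** B2 ** F) **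
            matrix_inv (mat 1))
         (transpose (matrix_inv (V' - transpose R ** Y)) ** E)
         (F ** matrix_inv (mat 1))"
    by (rule lmi_compensator_good[OF pos V'(2) _ V'(1)])
  then show "\<exists>Ac Bc Cc. good_compensator A B1 B2 C1 C2 D11 D12 D21 wmax ulim \<gamma> Ac Bc Cc"
    by blast
next
  fix \<delta> :: real assume \<delta>: "0 < \<delta>"
  obtain V' where "norm (V' - V) < \<delta>" "invertible (V' - transpose R ** Y)"
    "lmi_feasible A B1 B2 C1 C2 D11 D12 D21 wmax ulim \<alpha> \<gamma> \<epsilon>1 \<epsilon>2 \<epsilon>3
           R V' Y M11 M12 M13 M21 M22 M23 L E F"
    by (rule lmi_feasible_nearby_invertible[OF assms(10) \<delta>])
  then show "\<exists>R' V' Y' M11' M12' M13' M21' M22' M23' L' E' F'.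
       norm (R' - R) < \<delta> \<and> norm (V' - V) < \<delta> \<and> norm (Y' - Y) < \<delta> \<and>
       norm (M11' - M11) < \<delta> \<and> norm (M12' - M12) < \<delta> \<and> norm (M13' - M13) < \<delta> \<and>
       norm (M21' - M21) < \<delta> \<and> norm (M22' - M22) < \<delta> \<and> norm (M23' - M23) < \<delta> \<and>
       norm (L' - L) < \<delta> \<and> norm (E' - E) < \<delta> \<and> norm (F' - F) < \<delta> \<and>
       lmi_feasible A B1 B2 C1 C2 D11 D12 D21 wmax ulim \<alpha> \<gamma> \<epsilon>1 \<epsilon>2 \<epsilon>3
         R' V' Y' M11' M12' M13' M21' M22' M23' L' E' F' \<and>
       invertible (V' - transpose R' ** Y')"
    using \<delta>
    by - (rule exI[of _ R], rule exI[of _ V'], rule exI[of _ Y], rule exI[of _ M11],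
        rule exI[of _ M12], rule exI[of _ M13], rule exI[of _ M21], rule exI[of _ M22],
        rule exI[of _ M23], rule exI[of _ L], rule exI[of _ E], rule exI[of _ F], simp)
next
  fix G21 H21 :: "real^'n^'n"
  assume "invertible G21 \<and> invertible H21 \<and> transpose G21 ** H21 = V - transpose R ** Y"
  then show "good_compensator A B1 B2 C1 C2 D11 D12 D21 wmax ulim \<gamma>
         (transpose (matrix_inv H21) **
            (L - transpose Y ** A ** R - E ** C2 ** R - transpose Y ** B2 ** F) **
            matrix_inv G21)
         (transpose (matrix_inv H21) ** E)
         (F ** matrix_inv G21)"
    by (elim conjE) (rule lmi_compensator_good[OF assms(1-3) assms(10)])
qed

end
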